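(* Let $a<0$, $c<0$, $a_2>0$, $c_2>0$, $b>0$, $b_2>0$, let $0<|\omega|<\min\left\{1,\frac{-a}{b},\frac{-c}{b},\frac{a_2}{b_2},\frac{c_2}{b_2}\right\}$, and let $F:\mathbb{R}^4\to\mathbb{R}$ be $C^2$ with $F(0)=0$ satisfying conditions (a), (b), (c) of the context. Let $(\psi_0,v_0)\in X$ satisfy $P_\omega(\psi_0,v_0)=0$ and $J_\omega(\psi_0,v_0)=S(\omega)$. Then $(\psi_0,v_0)$ is a weak solution of the traveling-wave system, i.e. $J_\omega'(\psi_0,v_0)=0$ in the dual of $X$.
   Context: $X=H^2(\mathbb{R})\times H^2(\mathbb{R})$. For $(\psi,v)\in X$: $I_1(\psi,v)=\int_{\mathbb R}[\psi^2-c(\psi')^2+c_2(\psi'')^2+v^2-a(v')^2+a_2(v'')^2]\,dx$, $I_2(\psi,v)=\int_{\mathbb R}(\psi v+b\psi'v'+b_2\psi''v'')\,dx$, $I_\omega=I_1-2\omega I_2$. $F:\mathbb{R}^4\to\mathbb{R}$ is $C^2$, $F(0)=0$, $G(w)=w\cdot\nabla F(w)$. Conditions: (a) there is $p>0$ with $w\cdot\nabla G(w)\ge(p+2)G(w)$ for all $w\in\mathbb{R}^4$; (b) there exist $0<q_1\le q_2<\infty$, $C>0$ with $|D^2F(w)|\le C(|w|^{q_1}+|w|^{q_2})$; (c) there exist $u,v\in H^2(\mathbb{R})$ with $\int_{\mathbb R}F(u,u',v,v')\,dx>0$. $K(\psi,v)=\int F(\psi,\psi',v,v')\,dx$, $N(\psi,v)=\int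 G(\psi,\psi',v,v')\,dx$, $J_\omega=\tfrac12I_\omega-K$, $P_\omega=I_\omega-N$, $\mathcal M_\omega=\{P_\omega=0\}$, $S(\omega)=\inf\{J_\omega(\psi,v):(\psi,v)\in\mathcal M_\omega\setminus\{0\}\}$. Weak solutions of the traveling-wave equations of the higher-order Boussinesq system (with $b=d$, $b_2=d_2$) are, by definition, critical points of $J_\omega$ on $X$. *)

theory Defs
  imports "HOL-Analysis.Analysis"
begin

text \<open>Test functions: continuously differentiable with compact support
  (weak derivatives tested against C^1_c functions; equivalent to C^\<infinity>_c testing).\<close>
definition test_fun :: "(real \<Rightarrow> real) \<Rightarrow> bool" where
  "test_fun \<phi> \<longleftrightarrow> \<phi> C1_differentiable_on UNIV \<and> bounded {x. \<phi> x \<noteq> 0}"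

definition loc_integrable :: "(real \<Rightarrow> real) \<Rightarrow> bool" where
  "loc_integrable u \<longleftrightarrow> (\<forall>r s. set_integrable lborel {r..s} u)"

definition weak_deriv :: "(real \<Rightarrow> real) \<Rightarrow> (real \<Rightarrow> real) \<Rightarrow> bool" where
  "weak_deriv u u' \<longleftrightarrow> loc_integrable u \<and> loc_integrable u' \<and>
     (\<forall>\<phi>. test_fun \<phi> \<longrightarrow>
        (LINT x|lborel. u x * deriv \<phi> x) = - (LINT x|lborel. u' x * \<phi> x))"

definition sq_int :: "(real \<Rightarrow> real) \<Rightarrow> bool" where
  "sq_int f \<longleftrightarrow> f \<in> borel_measurable lborel \<and> integrable lborel (\<lambda>x. (f x)\<^sup>2)"

definition H2 :: "(real \<Rightarrow> real) \<Rightarrow> bool" where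
  "H2 u \<longleftrightarrow> (\<exists>u1 u2. sq_int u \<and> sq_int u1 \<and> sq_int u2 \<and> weak_deriv u u1 \<and> weak_deriv u1 u2)"

text \<open>A chosen weak derivative (determined up to a.e. equality).\<close>
definition wd :: "(real \<Rightarrow> real) \<Rightarrow> (real \<Rightarrow> real)" where
  "wd u = (SOME u'. weak_deriv u u')"

definition H2_norm_sq :: "(real \<Rightarrow> real) \<Rightarrow> real" where
  "H2_norm_sq u = (LINT x|lborel. (u x)\<^sup>2 + (wd u x)\<^sup>2 + (wd (wd u) x)\<^sup>2)"

definition X_norm :: "(real \<Rightarrow> real) \<Rightarrow> (real \<Rightarrow> real) \<Rightarrow> real" where
  "X_norm \<psi> v = sqrt (H2_norm_sq \<psi> + H2_norm_sq v)"

text \<open>Zero element of X (functions equal a.e. are identified).\<close>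
definition X_zero :: "(real \<Rightarrow> real) \<Rightarrow> (real \<Rightarrow> real) \<Rightarrow> bool" where
  "X_zero \<psi> v \<longleftrightarrow> (AE x in lborel. \<psi> x = 0 \<and> v x = 0)"

definition vec4 :: "real \<Rightarrow> real \<Rightarrow> real \<Rightarrow> real \<Rightarrow> real^4" where
  "vec4 x1 x2 x3 x4 = vector [x1, x2, x3, x4]"

definition grad :: "(real^4 \<Rightarrow> real) \<Rightarrow> real^4 \<Rightarrow> real^4" where
  "grad F w = (\<chi> i. frechet_derivative F (at w) (axis i 1))"

definition hess :: "(real^4 \<Rightarrow> real) \<Rightarrow> real^4 \<Rightarrow> real^4^4" where
  "hess F w = jacobian (grad F) (at w)"

definition C2_R4 :: "(real^4 \<Rightarrow> real) \<Rightarrow> bool" where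
  "C2_R4 F \<longleftrightarrow> (\<forall>w. F differentiable (at w)) \<and> (\<forall>w. grad F differentiable (at w))
     \<and> continuous_on UNIV (hess F)"

definition Gfun :: "(real^4 \<Rightarrow> real) \<Rightarrow> real^4 \<Rightarrow> real" where
  "Gfun F w = w \<bullet> grad F w"

definition I1 :: "real \<Rightarrow> real \<Rightarrow> real \<Rightarrow> real \<Rightarrow> (real \<Rightarrow> real) \<Rightarrow> (real \<Rightarrow> real) \<Rightarrow> real" where
  "I1 a a2 c c2 \<psi> v = (LINT x|lborel. (\<psi> x)\<^sup>2 - c * (wd \<psi> x)\<^sup>2 + c2 * (wd (wd \<psi>) x)\<^sup>2
      + (v x)\<^sup>2 - a * (wd v x)\<^sup>2 + a2 * (wd (wd v) x)\<^sup>2)"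

definition I2 :: "real \<Rightarrow> real \<Rightarrow> (real \<Rightarrow> real) \<Rightarrow> (real \<Rightarrow> real) \<Rightarrow> real" where
  "I2 b b2 \<psi> v = (LINT x|lborel. \<psi> x * v x + b * wd \<psi> x * wd v x + b2 * wd (wd \<psi>) x * wd (wd v) x)"

definition Iw :: "real \<Rightarrow> real \<Rightarrow> real \<Rightarrow> real \<Rightarrow> real \<Rightarrow> real \<Rightarrow> real \<Rightarrow> (real \<Rightarrow> real) \<Rightarrow> (real \<Rightarrow> real) \<Rightarrow> real" where
  "Iw a a2 c c2 b b2 \<omega> \<psi> v = I1 a a2 c c2 \<psi> v - 2 * \<omega> * I2 b b2 \<psi> v"

definition Kfun :: "(real^4 \<Rightarrow> real) \<Rightarrow> (real \<Rightarrow> real) \<Rightarrow> (real \<Rightarrow> real) \<Rightarrow> real" where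
  "Kfun F \<psi> v = (LINT x|lborel. F (vec4 (\<psi> x) (wd \<psi> x) (v x) (wd v x)))"

definition Nfun :: "(real^4 \<Rightarrow> real) \<Rightarrow> (real \<Rightarrow> real) \<Rightarrow> (real \<Rightarrow> real) \<Rightarrow> real" where
  "Nfun F \<psi> v = (LINT x|lborel. Gfun F (vec4 (\<psi> x) (wd \<psi> x) (v x) (wd v x)))"

definition Jw where
  "Jw a a2 c c2 b b2 \<omega> F \<psi> v = Iw a a2 c c2 b b2 \<omega> \<psi> v / 2 - Kfun F \<psi> v"

definition Pw where
  "Pw a a2 c c2 b b2 \<omega> F \<psi> v = Iw a a2 c c2 b b2 \<omega> \<psi> v - Nfun F \<psi> v"

definition Sw where
  "Sw a a2 c c2 b b2 \<omega> F = Inf {Jw a a2 c c2 b b2 \<omega> F \<psi> v | \<psi> v.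
      H2 \<psi> \<and> H2 v \<and> Pw a a2 c c2 b b2 \<omega> F \<psi> v = 0 \<and> \<not> X_zero \<psi> v}"

definition Jw_critical where
  "Jw_critical a a2 c c2 b b2 \<omega> F \<psi>0 v0 \<longleftrightarrow>
     (\<forall>\<epsilon>>0. \<exists>\<delta>>0. \<forall>h k. H2 h \<and> H2 k \<and> X_norm h k < \<delta> \<longrightarrow>
        \<bar>Jw a a2 c c2 b b2 \<omega> F (\<lambda>x. \<psi>0 x + h x) (\<lambda>x. v0 x + k x) - Jw a a2 c c2 b b2 \<omega> F \<psi>0 v0\<bar>
          \<le> \<epsilon> * X_norm h k)"

end

(* Write J for the functional and P(z) = J'(z) z for the Nehari constraint. Condition (a) makes J,
   restricted to the ray through a nonzero z with P(z) = 0, attain its maximum exactly at z. If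
   J'(z) were negative in some direction y, then for small s > 0 the functional on the ray through
   z + s y would have an interior maximum at some t close to 1; there P(t (z + s y)) = 0, and
   J(t (z + s y)) < J(t z) <= J(z) contradicts minimality. So no Lagrange multiplier is needed.
   J is differentiable on X because functions in H^1 of the line are essentially bounded, so the
   Lipschitz bounds for the gradient of F on balls suffice. The weak derivatives are handled through
   the fundamental theorem of calculus, obtained by testing with trapezoids at Lebesgue points. *)

theory Submission
  imports Defs
begin

section \<open>Weak derivatives\<close>

lemma loc_integrable_imp_borel:
  assumes "loc_integrable f"
  shows "f \<in> borel_measurable borel"
proof (rule borel_measurable_LIMSEQ_metric)
  show "(\<lambda>x. indicator {-real n..real n} x *\<^sub>R f x) \<in> borel_measurable borel" for n
    using assms unfolding loc_integrable_def set_integrable_def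
    by (metis borel_measurable_integrable measurable_lborel2)
  show "(\<lambda>n. indicator {-real n..real n} x *\<^sub>R f x) \<longlonglongrightarrow> f x" for x
  proof (rule tendsto_eventually)
    obtain N where "\<bar>x\<bar> \<le> real N"
      using real_arch_simple by blast
    then show "\<forall>\<^sub>F n in sequentially. indicator {-real n..real n} x *\<^sub>R f x = f x"
      by (intro eventually_sequentiallyI[of N]) (auto simp: indicator_def abs_le_iff)
  qed
qed

lemma loc_integrable_lincomb:
  assumes "loc_integrable f" "loc_integrable g"
  shows "loc_integrable (\<lambda>x. \<alpha> * f x + \<beta> * g x)"
  using assms unfolding loc_integrable_def
  by (intro allI set_integral_add(1) set_integrable_mult_right impI) blast+

lemma loc_integrable_cong_AE:
  assumes "loc_integrable f" "g \<in> borel_measurable borel" "AE x in lborel. f x = g x"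
  shows "loc_integrable g"
  unfolding loc_integrable_def set_integrable_def
proof (intro allI)
  fix r s
  show "integrable lborel (\<lambda>x. indicator {r..s} x *\<^sub>R g x)"
  proof (rule integrable_cong_AE_imp)
    show "integrable lborel (\<lambda>x. indicator {r..s} x *\<^sub>R f x)"
      using assms(1) unfolding loc_integrable_def set_integrable_def by blast
    show "AE x in lborel. indicator {r..s} x *\<^sub>R f x = indicator {r..s} x *\<^sub>R g x"
      using assms(3) by eventually_elim simp
  qed (use assms(2) in simp)
qed

lemma integrable_loc_integrable_mult:
  assumes f: "loc_integrable f" and g: "g \<in> borel_measurable borel"
    and bound: "\<And>x. \<bar>g x\<bar> \<le> B * indicator {-R..R} x"
  shows "integrable lborel (\<lambda>x. f x * g x)"
proof (rule Bochner_Integration.integrable_bound)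
  show "integrable lborel (\<lambda>x. B * (indicator {-R..R} x *\<^sub>R f x))"
    using f unfolding loc_integrable_def set_integrable_def
    by (intro integrable_mult_right) blast
  show "(\<lambda>x. f x * g x) \<in> borel_measurable lborel"
    using loc_integrable_imp_borel[OF f] g by simp
  have "norm (f x * g x) \<le> norm (B * (indicator {-R..R} x *\<^sub>R f x))" for x
    using mult_left_mono[OF order_trans[OF bound abs_ge_self], of "\<bar>f x\<bar>" x]
    by (simp add: abs_mult mult_ac)
  then show "AE x in lborel. norm (f x * g x) \<le> norm (B * (indicator {-R..R} x *\<^sub>R f x))"
    by simp
qed

lemma tendsto_integral_loc_integrable_mult:
  assumes f: "loc_integrable f" and g: "\<And>h. 0 < h \<Longrightarrow> h < 1 \<Longrightarrow> g h \<in> borel_measurable borel"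
    and bound: "\<And>h x. 0 < h \<Longrightarrow> h < 1 \<Longrightarrow> \<bar>g h x\<bar> \<le> B * indicator {-R..R} x"
    and lim: "\<And>x. ((\<lambda>h. g h x) \<longlongrightarrow> k x) (at_right (0::real))"
  shows "((\<lambda>h. LINT x|lborel. f x * g h x) \<longlongrightarrow> (LINT x|lborel. f x * k x)) (at_right 0)"
proof (rule tendsto_at_right_sequentially[OF zero_less_one])
  fix \<sigma> :: "nat \<Rightarrow> real" assume \<sigma>: "\<And>n. 0 < \<sigma> n" "\<And>n. \<sigma> n < 1" "\<sigma> \<longlonglongrightarrow> 0"
  then have "filterlim \<sigma> (at_right 0) sequentially"
    by (simp add: filterlim_at less_imp_neq[symmetric])
  then have lim_\<sigma>: "(\<lambda>n. g (\<sigma> n) x) \<longlonglongrightarrow> k x" for x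
    by (rule filterlim_compose[OF lim])
  have g_\<sigma>: "g (\<sigma> n) \<in> borel_measurable borel" for n
    using g \<sigma> by blast
  have [measurable]: "f \<in> borel_measurable borel" "k \<in> borel_measurable borel"
    using loc_integrable_imp_borel[OF f] borel_measurable_LIMSEQ_metric[OF g_\<sigma> lim_\<sigma>] by auto
  show "(\<lambda>n. LINT x|lborel. f x * g (\<sigma> n) x) \<longlonglongrightarrow> (LINT x|lborel. f x * k x)"
  proof (rule integral_dominated_convergence)
    show "integrable lborel (\<lambda>x. norm (f x * (B * indicator {-R..R} x)))"
      by (intro integrable_norm integrable_loc_integrable_mult[OF f, of _ "\<bar>B\<bar>" R])
        (auto simp: abs_mult)
    show "AE x in lborel. norm (f x * g (\<sigma> n) x) \<le> norm (f x * (B * indicator {-R..R} x))" for n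
      using order_trans[OF bound[OF \<sigma>(1,2)] abs_ge_self, of n]
      by (intro AE_I2) (auto simp: abs_mult intro: mult_left_mono)
    show "AE x in lborel. (\<lambda>n. f x * g (\<sigma> n) x) \<longlonglongrightarrow> f x * k x"
      by (intro AE_I2 tendsto_intros lim_\<sigma>)
  qed (use g_\<sigma> in simp_all)
qed

lemma continuous_antiderivative:
  fixes g :: "real \<Rightarrow> real"
  assumes "continuous_on UNIV g"
  obtains \<Phi> where "\<And>x. (\<Phi> has_real_derivative g x) (at x)"
proof -
  have "\<exists>\<Phi>. \<forall>x::real. -\<infinity> < ereal x \<longrightarrow> ereal x < \<infinity> \<longrightarrow> (\<Phi> has_vector_derivative g x) (at x)"
    using assms by (intro einterval_antiderivative) (auto simp: continuous_on_eq_continuous_at)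
  then show thesis
    using that by (auto simp: has_real_derivative_iff_has_vector_derivative)
qed

lemma test_funI:
  assumes "\<And>x. (\<phi> has_real_derivative \<phi>' x) (at x)" "continuous_on UNIV \<phi>'"
    and "\<And>x. R < \<bar>x\<bar> \<Longrightarrow> \<phi> x = 0"
  shows "test_fun \<phi>"
proof -
  have "{x. \<phi> x \<noteq> 0} \<subseteq> {-R..R}"
    using assms(3) by (force simp: abs_le_iff not_less)
  then have "bounded {x. \<phi> x \<noteq> 0}"
    using bounded_subset bounded_closed_interval by blast
  then show ?thesis
    using assms(1,2) unfolding test_fun_def C1_differentiable_on_def
    by (auto simp: has_real_derivative_iff_has_vector_derivative)
qed

lemma test_fun_continuous:
  assumes "test_fun \<phi>"
  shows "continuous_on UNIV \<phi>" "continuous_on UNIV (deriv \<phi>)"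
proof -
  obtain D where D: "continuous_on UNIV D" "\<And>x. (\<phi> has_real_derivative D x) (at x)"
    using assms unfolding test_fun_def C1_differentiable_on_def
    by (auto simp: has_real_derivative_iff_has_vector_derivative)
  then have "deriv \<phi> = D"
    using DERIV_imp_deriv by blast
  with D show "continuous_on UNIV \<phi>" "continuous_on UNIV (deriv \<phi>)"
    by (auto intro: continuous_at_imp_continuous_on DERIV_isCont)
qed

lemma continuous_compact_support_bound:
  fixes g :: "real \<Rightarrow> real"
  assumes "continuous_on UNIV g" "\<And>x. R < \<bar>x\<bar> \<Longrightarrow> g x = 0"
  obtains B where "\<And>x. \<bar>g x\<bar> \<le> B * indicator {-R..R} x"
proof -
  have "bounded (g ` {-R..R})"
    by (intro compact_imp_bounded compact_continuous_image continuous_on_subset[OF assms(1)]) auto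
  then obtain B where "\<And>x. x \<in> {-R..R} \<Longrightarrow> \<bar>g x\<bar> \<le> B"
    unfolding bounded_iff by (metis image_eqI real_norm_def)
  then have "\<bar>g x\<bar> \<le> B * indicator {-R..R} x" for x
    using assms(2)[of x] by (cases "R < \<bar>x\<bar>") (auto simp: indicator_def)
  then show thesis
    by (rule that)
qed

lemma integrable_mult_test_fun:
  assumes f: "loc_integrable f" and \<phi>: "test_fun \<phi>"
  shows "integrable lborel (\<lambda>x. f x * \<phi> x)" "integrable lborel (\<lambda>x. f x * deriv \<phi> x)"
proof -
  obtain R where R: "\<And>x. R < \<bar>x\<bar> \<Longrightarrow> \<phi> x = 0"
    using \<phi> unfolding test_fun_def bounded_iff by (metis mem_Collect_eq not_less real_norm_def)
  have "deriv \<phi> x = 0" if "R < \<bar>x\<bar>" for x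
  proof (rule DERIV_imp_deriv)
    have "open {x. R < \<bar>x\<bar>}"
      by (intro open_Collect_less continuous_intros)
    then show "(\<phi> has_real_derivative 0) (at x)"
      by (rule has_field_derivative_transform_within_open[OF DERIV_const[of 0]])
        (use that R in auto)
  qed
  with R test_fun_continuous[OF \<phi>]
  obtain B B' where "\<And>x. \<bar>\<phi> x\<bar> \<le> B * indicator {-R..R} x"
    "\<And>x. \<bar>deriv \<phi> x\<bar> \<le> B' * indicator {-R..R} x"
    by (metis continuous_compact_support_bound)
  then show "integrable lborel (\<lambda>x. f x * \<phi> x)" "integrable lborel (\<lambda>x. f x * deriv \<phi> x)"
    using test_fun_continuous[OF \<phi>] f
    by (auto intro!: integrable_loc_integrable_mult borel_measurable_continuous_onI)
qed

lemma weak_deriv_loc_integrable: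
  assumes "weak_deriv u u'"
  shows "loc_integrable u" "loc_integrable u'"
  using assms by (auto simp: weak_deriv_def)

lemma weak_deriv_cong_AE:
  assumes u: "weak_deriv u u'" and eq: "AE x in lborel. u x = w x"
    and w: "w \<in> borel_measurable borel"
  shows "weak_deriv w u'"
proof -
  have lw: "loc_integrable w"
    using loc_integrable_cong_AE weak_deriv_loc_integrable(1)[OF u] w eq by blast
  have "(LINT x|lborel. u x * deriv \<phi> x) = (LINT x|lborel. w x * deriv \<phi> x)" if "test_fun \<phi>" for \<phi>
    using eq integrable_mult_test_fun(2)[OF weak_deriv_loc_integrable(1)[OF u] that]
      integrable_mult_test_fun(2)[OF lw that]
    by (intro integral_cong_AE) auto
  then show ?thesis
    using u lw unfolding weak_deriv_def by auto
qed

lemma weak_deriv_lincomb: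
  assumes u: "weak_deriv u u'" and v: "weak_deriv v v'"
  shows "weak_deriv (\<lambda>x. \<alpha> * u x + \<beta> * v x) (\<lambda>x. \<alpha> * u' x + \<beta> * v' x)"
proof -
  note loc = weak_deriv_loc_integrable[OF u] weak_deriv_loc_integrable[OF v]
  have "(LINT x|lborel. (\<alpha> * u x + \<beta> * v x) * deriv \<phi> x)
      = - (LINT x|lborel. (\<alpha> * u' x + \<beta> * v' x) * \<phi> x)" if \<phi>: "test_fun \<phi>" for \<phi>
    using u v \<phi> loc[THEN integrable_mult_test_fun(1)[OF _ \<phi>]]
      loc[THEN integrable_mult_test_fun(2)[OF _ \<phi>]]
    unfolding weak_deriv_def by (simp add: distrib_right mult.assoc)
  then show ?thesis
    using loc loc_integrable_lincomb unfolding weak_deriv_def by blast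
qed

definition left_average :: "real \<Rightarrow> (real \<Rightarrow> real) \<Rightarrow> real \<Rightarrow> real" where
  "left_average \<delta> \<phi> t = (LINT s:{t - \<delta>..t}|lborel. \<phi> s) / \<delta>"

lemma left_average_eq_difference_quotient:
  assumes \<phi>: "continuous_on UNIV \<phi>" and "0 < \<delta>"
  obtains \<Phi> where "\<And>t. (\<Phi> has_real_derivative \<phi> t) (at t)"
    "left_average \<delta> \<phi> = (\<lambda>t. (\<Phi> t - \<Phi> (t - \<delta>)) / \<delta>)"
proof -
  obtain \<Phi> where \<Phi>: "\<And>t. (\<Phi> has_real_derivative \<phi> t) (at t)"
    using continuous_antiderivative[OF \<phi>] by blast
  then have "(LINT s:{t - \<delta>..t}|lborel. \<phi> s) = \<Phi> t - \<Phi> (t - \<delta>)" for t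
    unfolding set_lebesgue_integral_def using \<open>0 < \<delta>\<close> \<phi>
    by (intro integral_FTC_atLeastAtMost)
      (auto simp: has_real_derivative_iff_has_vector_derivative
        intro: has_vector_derivative_at_within continuous_on_subset)
  with \<Phi> show thesis
    by (intro that[of \<Phi>]) (auto simp: left_average_def)
qed

lemma left_average_mvt:
  assumes "continuous_on UNIV \<phi>" "0 < \<delta>"
  obtains \<xi> where "t - \<delta> < \<xi>" "\<xi> < t" "left_average \<delta> \<phi> t = \<phi> \<xi>"
proof -
  obtain \<Phi> where \<Phi>: "\<And>t. (\<Phi> has_real_derivative \<phi> t) (at t)"
    "left_average \<delta> \<phi> = (\<lambda>t. (\<Phi> t - \<Phi> (t - \<delta>)) / \<delta>)"
    using left_average_eq_difference_quotient[OF assms] by blast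
  obtain \<xi> where "t - \<delta> < \<xi>" "\<xi> < t" "\<Phi> t - \<Phi> (t - \<delta>) = \<delta> * \<phi> \<xi>"
    using MVT2[of "t - \<delta>" t \<Phi> \<phi>] \<Phi>(1) assms(2) by auto
  then show thesis
    using assms(2) by (intro that[of \<xi>]) (auto simp: \<Phi>(2))
qed

lemma DERIV_left_average:
  assumes "continuous_on UNIV \<phi>" "0 < \<delta>"
  shows "(left_average \<delta> \<phi> has_real_derivative (\<phi> t - \<phi> (t - \<delta>)) / \<delta>) (at t)"
proof -
  obtain \<Phi> where \<Phi>: "\<And>t. (\<Phi> has_real_derivative \<phi> t) (at t)"
    "left_average \<delta> \<phi> = (\<lambda>t. (\<Phi> t - \<Phi> (t - \<delta>)) / \<delta>)"
    using left_average_eq_difference_quotient[OF assms] by blast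
  show ?thesis
    unfolding \<Phi>(2) using DERIV_shift[of \<Phi> "\<phi> (t - \<delta>)" t "- \<delta>"] \<Phi>(1)
    by (intro DERIV_cdivide DERIV_diff) auto
qed

lemma left_average_bound:
  assumes "continuous_on UNIV \<phi>" "0 < \<delta>" "\<delta> \<le> 1" and bound: "\<And>t. \<bar>\<phi> t\<bar> \<le> B * indicator {-R..R} t"
  shows "\<bar>left_average \<delta> \<phi> t\<bar> \<le> \<bar>B\<bar> * indicator {-(R + 1)..R + 1} t"
proof -
  obtain \<xi> where "t - \<delta> < \<xi>" "\<xi> < t" "left_average \<delta> \<phi> t = \<phi> \<xi>"
    using left_average_mvt[OF assms(1,2)] by blast
  then show ?thesis
    using bound[of \<xi>] assms(3) by (cases "\<xi> \<in> {-R..R}") auto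
qed

lemma test_fun_left_average:
  assumes \<phi>: "continuous_on UNIV \<phi>" and \<delta>: "0 < \<delta>" "\<delta> \<le> 1"
    and bound: "\<And>t. \<bar>\<phi> t\<bar> \<le> B * indicator {-R..R} t"
  shows "test_fun (left_average \<delta> \<phi>)"
proof (rule test_funI[OF DERIV_left_average[OF \<phi> \<delta>(1)]])
  show "continuous_on UNIV (\<lambda>t. (\<phi> t - \<phi> (t - \<delta>)) / \<delta>)"
    using \<delta> by (intro continuous_intros continuous_on_compose2[OF \<phi>]) auto
  show "left_average \<delta> \<phi> t = 0" if "R + 1 < \<bar>t\<bar>" for t
    using left_average_bound[OF assms, of t] that
    by (auto simp: indicator_def abs_if split: if_splits)
qed

lemma tendsto_left_average:
  assumes \<phi>: "continuous_on UNIV \<phi>"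
  shows "((\<lambda>\<delta>. left_average \<delta> \<phi> t) \<longlongrightarrow> \<phi> t) (at_right 0)"
proof (rule tendstoI)
  fix e :: real assume "0 < e"
  then obtain d where d: "d > 0" "\<And>s. dist s t < d \<Longrightarrow> dist (\<phi> s) (\<phi> t) < e"
    using \<phi> unfolding continuous_on_iff by (metis UNIV_I)
  have "dist (left_average \<delta> \<phi> t) (\<phi> t) < e" if \<delta>: "0 < \<delta>" "\<delta> < d" for \<delta>
  proof -
    obtain \<xi> where "t - \<delta> < \<xi>" "\<xi> < t" "left_average \<delta> \<phi> t = \<phi> \<xi>"
      using left_average_mvt[OF \<phi> \<delta>(1)] by blast
    then show ?thesis
      using d(2)[of \<xi>] \<delta>(2) by (simp add: dist_real_def)
  qed
  then show "\<forall>\<^sub>F \<delta> in at_right 0. dist (left_average \<delta> \<phi> t) (\<phi> t) < e"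
    unfolding eventually_at_right_field using d(1) by blast
qed

lemma tendsto_left_difference_quotient:
  fixes \<phi> :: "real \<Rightarrow> real"
  assumes "(\<phi> has_real_derivative D) (at_left t)"
  shows "((\<lambda>\<delta>. (\<phi> t - \<phi> (t - \<delta>)) / \<delta>) \<longlongrightarrow> D) (at_right 0)"
proof -
  have "filterlim (\<lambda>\<delta>. t - \<delta>) (at_left t) (at_right 0)"
    unfolding filterlim_at
    by (auto intro!: tendsto_eq_intros exI[of _ 1] simp: eventually_at_right_field)
  with assms have "((\<lambda>\<delta>. (\<phi> (t - \<delta>) - \<phi> t) / (t - \<delta> - t)) \<longlongrightarrow> D) (at_right 0)"
    unfolding has_field_derivative_iff by (rule filterlim_compose)
  then show ?thesis
    by (simp add: minus_divide_left)
qed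

lemma weak_deriv_lipschitz_test:
  assumes u: "weak_deriv u u'" and lip: "L-lipschitz_on UNIV \<phi>"
    and supp: "\<And>t. R < \<bar>t\<bar> \<Longrightarrow> \<phi> t = 0"
    and deriv: "\<And>t. (\<phi> has_real_derivative D t) (at_left t)"
  shows "(LINT t|lborel. u t * D t) = - (LINT t|lborel. u' t * \<phi> t)"
proof (rule tendsto_unique[OF trivial_limit_at_right_real])
  have cont: "continuous_on UNIV \<phi>"
    by (rule lipschitz_on_continuous_on[OF lip])
  then obtain B where B: "\<And>t. \<bar>\<phi> t\<bar> \<le> B * indicator {-R..R} t"
    using continuous_compact_support_bound supp by blast
  define \<psi> where "\<psi> \<delta> = left_average \<delta> \<phi>" for \<delta>
  have test: "test_fun (\<psi> \<delta>)" if "0 < \<delta>" "\<delta> < 1" for \<delta>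
    unfolding \<psi>_def using that by (intro test_fun_left_average[OF cont _ _ B]) auto
  have deriv_\<psi>: "deriv (\<psi> \<delta>) t = (\<phi> t - \<phi> (t - \<delta>)) / \<delta>" if "0 < \<delta>" for \<delta> t
    unfolding \<psi>_def by (rule DERIV_imp_deriv[OF DERIV_left_average[OF cont that]])
  show "((\<lambda>\<delta>. LINT t|lborel. u t * deriv (\<psi> \<delta>) t) \<longlongrightarrow> (LINT t|lborel. u t * D t)) (at_right 0)"
  proof (rule tendsto_integral_loc_integrable_mult[OF weak_deriv_loc_integrable(1)[OF u]])
    show "\<bar>deriv (\<psi> \<delta>) t\<bar> \<le> L * indicator {-(R + 1)..R + 1} t" if "0 < \<delta>" "\<delta> < 1" for \<delta> t
      using lipschitz_on_normD[OF lip, of t "t - \<delta>"] that supp[of t] supp[of "t - \<delta>"]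
      by (cases "R + 1 < \<bar>t\<bar>") (auto simp: deriv_\<psi> divide_simps indicator_def)
    show "((\<lambda>\<delta>. deriv (\<psi> \<delta>) t) \<longlongrightarrow> D t) (at_right 0)" for t
      using tendsto_left_difference_quotient[OF deriv[of t]]
      by (rule Lim_transform_eventually)
        (auto simp: eventually_at_right_field deriv_\<psi> intro!: exI[of _ 1])
  qed (rule borel_measurable_continuous_onI[OF test_fun_continuous(2)[OF test]])
  have "((\<lambda>\<delta>. LINT t|lborel. u' t * \<psi> \<delta> t) \<longlongrightarrow> (LINT t|lborel. u' t * \<phi> t)) (at_right 0)"
  proof (rule tendsto_integral_loc_integrable_mult[OF weak_deriv_loc_integrable(2)[OF u]])
    show "\<bar>\<psi> \<delta> t\<bar> \<le> \<bar>B\<bar> * indicator {-(R + 1)..R + 1} t" if "0 < \<delta>" "\<delta> < 1" for \<delta> t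
      unfolding \<psi>_def using that by (intro left_average_bound[OF cont _ _ B]) auto
    show "((\<lambda>\<delta>. \<psi> \<delta> t) \<longlongrightarrow> \<phi> t) (at_right 0)" for t
      unfolding \<psi>_def by (rule tendsto_left_average[OF cont])
  qed (rule borel_measurable_continuous_onI[OF test_fun_continuous(1)[OF test]])
  then have "((\<lambda>\<delta>. - (LINT t|lborel. u' t * \<psi> \<delta> t)) \<longlongrightarrow> - (LINT t|lborel. u' t * \<phi> t)) (at_right 0)"
    by (rule tendsto_minus)
  then show "((\<lambda>\<delta>. LINT t|lborel. u t * deriv (\<psi> \<delta>) t)
      \<longlongrightarrow> - (LINT t|lborel. u' t * \<phi> t)) (at_right 0)"
    by (rule Lim_transform_eventually)
      (use u test in \<open>auto simp: eventually_at_right_field weak_deriv_def intro!: exI[of _ 1]\<close>)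
qed

definition ramp :: "real \<Rightarrow> real \<Rightarrow> real \<Rightarrow> real" where
  "ramp h x t = max 0 (min 1 ((t - x) / h))"

lemma ramp_eq_0: "0 < h \<Longrightarrow> t \<le> x \<Longrightarrow> ramp h x t = 0"
  by (simp add: ramp_def divide_nonpos_pos)

lemma ramp_eq_1: "0 < h \<Longrightarrow> x + h \<le> t \<Longrightarrow> ramp h x t = 1"
  by (simp add: ramp_def field_simps)

lemma lipschitz_ramp:
  assumes "0 < h"
  shows "(1 / h)-lipschitz_on UNIV (ramp h x)"
proof (rule lipschitz_onI)
  fix s t :: real
  have "dist (ramp h x s) (ramp h x t) \<le> \<bar>(s - x) / h - (t - x) / h\<bar>"
    unfolding ramp_def dist_real_def by linarith
  also have "\<dots> = 1 / h * dist s t"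
    using assms by (simp add: dist_real_def flip: diff_divide_distrib)
  finally show "dist (ramp h x s) (ramp h x t) \<le> 1 / h * dist s t" .
qed (use assms in simp)

lemma DERIV_ramp_at_left:
  assumes "0 < h"
  shows "(ramp h x has_real_derivative indicator {x<..x+h} t / h) (at_left t)"
proof -
  have transfer: ?thesis
    if g: "(g has_real_derivative indicator {x<..x+h} t / h) (at t)" and "0 < e"
      and eq: "\<And>s. t - e < s \<Longrightarrow> s \<le> t \<Longrightarrow> g s = ramp h x s" for g e
  proof (rule has_field_derivative_subset)
    show "(ramp h x has_real_derivative indicator {x<..x+h} t / h) (at t within {..t})"
      by (rule has_field_derivative_transform_within
          [OF has_field_derivative_at_within[OF g] \<open>0 < e\<close>])
        (use eq in \<open>auto simp: dist_real_def\<close>)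
  qed auto
  consider (left) "t \<le> x" | (slope) "x < t" "t \<le> x + h" | (right) "x + h < t"
    by linarith
  then show ?thesis
  proof cases
    case left
    then show ?thesis
      by (intro transfer[of "\<lambda>_. 0" 1]) (use assms ramp_eq_0 in auto)
  next
    case slope
    have "((\<lambda>s. (s - x) / h) has_real_derivative 1 / h) (at t)"
      using assms by (auto intro!: derivative_eq_intros)
    with slope show ?thesis
      by (intro transfer[of "\<lambda>s. (s - x) / h" "t - x"]) (use assms in \<open>auto simp: ramp_def\<close>)
  next
    case right
    then show ?thesis
      by (intro transfer[of "\<lambda>_. 1" "t - (x + h)"]) (use assms ramp_eq_1 in auto)
  qed
qed

lemma tendsto_ramp: "((\<lambda>h. ramp h x t) \<longlongrightarrow> indicator {x<..} t) (at_right 0)"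
proof (rule tendsto_eventually)
  have "ramp h x t = indicator {x<..} t" if "0 < h" "h < (if x < t then t - x else 1)" for h
    using that ramp_eq_0[of h t x] ramp_eq_1[of h x t] by (auto split: if_splits)
  then show "\<forall>\<^sub>F h in at_right 0. ramp h x t = indicator {x<..} t"
    unfolding eventually_at_right_field
    by (intro exI[of _ "if x < t then t - x else 1"]) auto
qed

lemma weak_deriv_ramp_test:
  assumes u: "weak_deriv u u'" and h: "0 < h"
  shows "(LINT t:{x..x+h}|lborel. u t) / h - (LINT t:{y..y+h}|lborel. u t) / h
    = - (LINT t|lborel. u' t * (ramp h x t - ramp h y t))"
proof -
  have slope: "integrable lborel (\<lambda>t. u t * indicator {z<..z+h} t / h)"
    "(LINT t|lborel. u t * indicator {z<..z+h} t / h) = (LINT t:{z..z+h}|lborel. u t) / h" for z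
  proof -
    have "set_integrable lborel {z..z+h} u"
      using weak_deriv_loc_integrable(1)[OF u] by (simp add: loc_integrable_def)
    then have "set_integrable lborel {z<..z+h} u"
      by (rule set_integrable_subset) auto
    then show "integrable lborel (\<lambda>t. u t * indicator {z<..z+h} t / h)"
      by (simp add: set_integrable_def mult.commute)
    show "(LINT t|lborel. u t * indicator {z<..z+h} t / h) = (LINT t:{z..z+h}|lborel. u t) / h"
      using h interval_integral_Ioc[of z "z + h" u] interval_integral_Icc[of z "z + h" u]
      by (simp add: set_lebesgue_integral_def mult.commute)
  qed
  have "(LINT t|lborel. u t * (indicator {x<..x+h} t / h - indicator {y<..y+h} t / h))
      = - (LINT t|lborel. u' t * (ramp h x t - ramp h y t))"
  proof (rule weak_deriv_lipschitz_test[OF u])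
    show "(1 / h + 1 / h)-lipschitz_on UNIV (\<lambda>t. ramp h x t - ramp h y t)"
      by (intro lipschitz_on_diff lipschitz_ramp h)
    show "ramp h x t - ramp h y t = 0" if "\<bar>x\<bar> + \<bar>y\<bar> + h < \<bar>t\<bar>" for t
      using h that ramp_eq_0[OF h] ramp_eq_1[OF h] by (cases "0 < t") auto
    show "((\<lambda>t. ramp h x t - ramp h y t) has_real_derivative
        indicator {x<..x+h} t / h - indicator {y<..y+h} t / h) (at_left t)" for t
      by (intro DERIV_diff DERIV_ramp_at_left h)
  qed
  then show ?thesis
    using Bochner_Integration.integral_diff[OF slope(1)[of x] slope(1)[of y]]
    by (simp only: slope(2) right_diff_distrib times_divide_eq_right)
qed

lemma tendsto_integral_ramp:
  assumes f: "loc_integrable f" and "x \<le> y"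
  shows "((\<lambda>h. LINT t|lborel. f t * (ramp h x t - ramp h y t))
    \<longlongrightarrow> (LINT t:{x..y}|lborel. f t)) (at_right 0)"
proof -
  have "((\<lambda>h. LINT t|lborel. f t * (ramp h x t - ramp h y t))
    \<longlongrightarrow> (LINT t|lborel. f t * (indicator {x<..} t - indicator {y<..} t))) (at_right 0)"
  proof (rule tendsto_integral_loc_integrable_mult[OF f])
    show "(\<lambda>t. ramp h x t - ramp h y t) \<in> borel_measurable borel" for h
      unfolding ramp_def by measurable
    show "\<bar>ramp h x t - ramp h y t\<bar> \<le> 1 * indicator {-(\<bar>x\<bar> + \<bar>y\<bar> + 1)..\<bar>x\<bar> + \<bar>y\<bar> + 1} t"
      if "0 < h" "h < 1" for h t
    proof (cases "t \<in> {-(\<bar>x\<bar> + \<bar>y\<bar> + 1)..\<bar>x\<bar> + \<bar>y\<bar> + 1}")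
      case True
      then show ?thesis
        by (simp add: ramp_def)
    next
      case False
      with that have "ramp h x t = ramp h y t"
        using ramp_eq_0[OF that(1), of t] ramp_eq_1[OF that(1), of _ t] by (cases "0 < t") auto
      then show ?thesis
        by simp
    qed
    show "((\<lambda>h. ramp h x t - ramp h y t) \<longlongrightarrow> indicator {x<..} t - indicator {y<..} t)
      (at_right 0)" for t
      by (intro tendsto_diff tendsto_ramp)
  qed
  also have "(LINT t|lborel. f t * (indicator {x<..} t - indicator {y<..} t))
      = (LINT t:{x<..y}|lborel. f t)"
    unfolding set_lebesgue_integral_def using \<open>x \<le> y\<close>
    by (intro Bochner_Integration.integral_cong) (auto simp: indicator_def)
  also have "\<dots> = (LINT t:{x..y}|lborel. f t)"
    using \<open>x \<le> y\<close> interval_integral_Ioc[of x y f] interval_integral_Icc[of x y f] by simp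
  finally show ?thesis .
qed

lemma AE_tendsto_right_average:
  assumes f: "loc_integrable f"
  shows "AE x in lborel. ((\<lambda>h. (LINT t:{x..x+h}|lborel. f t) / h) \<longlongrightarrow> f x) (at_right 0)"
proof -
  have f_Icc: "set_integrable lborel {a..b} f" for a b
    using f by (simp add: loc_integrable_def)
  obtain N where N: "negligible N" "\<And>x e. x \<notin> N \<Longrightarrow> 0 < e \<Longrightarrow>
      \<exists>d>0. \<forall>h. 0 < h \<and> h < d \<longrightarrow>
        norm (integral (cbox x (x + h *\<^sub>R One)) f /\<^sub>R h ^ DIM(real) - f x) < e"
    by (rule integrable_ccontinuous_explicit[of f])
      (auto simp: set_borel_integral_eq_integral(1)[OF f_Icc])
  have "((\<lambda>h. (LINT t:{x..x+h}|lborel. f t) / h) \<longlongrightarrow> f x) (at_right 0)" if "x \<notin> N" for x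
  proof (rule tendstoI)
    fix e :: real assume "0 < e"
    with N(2)[OF that, of e] obtain d where "d > 0"
      "\<And>h. 0 < h \<Longrightarrow> h < d \<Longrightarrow> \<bar>integral {x..x+h} f / h - f x\<bar> < e"
      by (auto simp: divide_inverse_commute)
    then show "\<forall>\<^sub>F h in at_right 0. dist ((LINT t:{x..x+h}|lborel. f t) / h) (f x) < e"
      unfolding eventually_at_right_field
      by (intro exI[of _ d]) (auto simp: set_borel_integral_eq_integral(2)[OF f_Icc] dist_real_def)
  qed
  moreover have "AE x in lebesgue. x \<notin> N"
    using N(1) by (intro AE_not_in) (simp add: negligible_iff_null_sets)
  then have "AE x in lborel. x \<notin> N"
    by (simp add: AE_completion_iff)
  ultimately show ?thesis
    by (auto elim: eventually_mono)
qed

lemma weak_deriv_FTC: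
  assumes u: "weak_deriv u u'"
  shows "AE x in lborel. AE y in lborel. x \<le> y \<longrightarrow> u y - u x = (LINT t:{x..y}|lborel. u' t)"
proof -
  define lebesgue_point where "lebesgue_point x \<longleftrightarrow>
    ((\<lambda>h. (LINT t:{x..x+h}|lborel. u t) / h) \<longlongrightarrow> u x) (at_right 0)" for x
  have AE_leb: "AE x in lborel. lebesgue_point x"
    unfolding lebesgue_point_def
    by (rule AE_tendsto_right_average[OF weak_deriv_loc_integrable(1)[OF u]])
  have "u y - u x = (LINT t:{x..y}|lborel. u' t)"
    if "lebesgue_point x" "lebesgue_point y" "x \<le> y" for x y
  proof -
    let ?d = "\<lambda>h. LINT t|lborel. u' t * (ramp h x t - ramp h y t)"
    have "((\<lambda>h. - ?d h) \<longlongrightarrow> u x - u y) (at_right 0)"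
      using tendsto_diff[OF that(1,2)[unfolded lebesgue_point_def]]
      by (rule Lim_transform_eventually)
        (auto simp: eventually_at_right_field weak_deriv_ramp_test[OF u] intro!: exI[of _ 1])
    moreover have "((\<lambda>h. - ?d h) \<longlongrightarrow> - (LINT t:{x..y}|lborel. u' t)) (at_right 0)"
      by (intro tendsto_minus tendsto_integral_ramp weak_deriv_loc_integrable(2)[OF u] that)
    ultimately show ?thesis
      using tendsto_unique[OF trivial_limit_at_right_real] by fastforce
  qed
  then have "AE y in lborel. x \<le> y \<longrightarrow> u y - u x = (LINT t:{x..y}|lborel. u' t)"
    if "lebesgue_point x" for x
    using AE_leb that by (auto elim: eventually_mono)
  with AE_leb show ?thesis
    by (auto elim: eventually_mono)
qed

lemma weak_deriv_zero_imp_AE_zero: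
  assumes u: "weak_deriv (\<lambda>_. 0) u'"
  shows "AE x in lborel. u' x = 0"
proof -
  note loc = weak_deriv_loc_integrable(2)[OF u]
  have "(LINT t:{x..y}|lborel. u' t) = 0" if "x \<le> y" for x y
  proof (rule tendsto_unique[OF trivial_limit_at_right_real tendsto_integral_ramp[OF loc that]])
    show "((\<lambda>h. LINT t|lborel. u' t * (ramp h x t - ramp h y t)) \<longlongrightarrow> 0) (at_right 0)"
      using weak_deriv_ramp_test[OF u, of _ x y]
      by (intro tendsto_eventually) (auto simp: eventually_at_right_field intro!: exI[of _ 1])
  qed
  then have "((\<lambda>h. (LINT t:{x..x+h}|lborel. u' t) / h) \<longlongrightarrow> 0) (at_right 0)" for x
    by (intro tendsto_eventually) (auto simp: eventually_at_right_field intro!: exI[of _ 1])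
  with AE_tendsto_right_average[OF loc] show ?thesis
    by (auto elim!: eventually_mono dest: tendsto_unique[OF trivial_limit_at_right_real])
qed

lemma weak_deriv_unique:
  assumes "weak_deriv u u1" "weak_deriv u u2"
  shows "AE x in lborel. u1 x = u2 x"
proof -
  have "AE x in lborel. 1 * u1 x + - 1 * u2 x = 0"
    using weak_deriv_lincomb[OF assms, of 1 "- 1"] by (intro weak_deriv_zero_imp_AE_zero) simp
  then show ?thesis
    by simp
qed

section \<open>Sobolev functions on the line\<close>

lemma sq_int_imp_loc_integrable:
  assumes "sq_int f"
  shows "loc_integrable f"
  unfolding loc_integrable_def set_integrable_def
proof (intro allI)
  fix r s :: real
  show "integrable lborel (\<lambda>x. indicator {r..s} x *\<^sub>R f x)"
  proof (rule Bochner_Integration.integrable_bound)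
    show "integrable lborel (\<lambda>x. indicator {r..s} x + (f x)\<^sup>2)"
      using assms unfolding sq_int_def
      by (intro Bochner_Integration.integrable_add integrable_real_indicator)
        (auto simp: emeasure_lborel_Icc_eq)
    show "(\<lambda>x. indicator {r..s} x *\<^sub>R f x) \<in> borel_measurable lborel"
      using assms unfolding sq_int_def by auto
    have "\<bar>y\<bar> \<le> 1 + y\<^sup>2" for y :: real
      using zero_le_power2[of "\<bar>y\<bar> - 1/2"] by (simp add: power2_eq_square algebra_simps)
    then show "AE x in lborel. norm (indicator {r..s} x *\<^sub>R f x)
        \<le> norm (indicator {r..s} x + (f x)\<^sup>2)"
      by (auto simp: indicator_def)
  qed
qed

lemma power2_sum_le: "(x + y)\<^sup>2 \<le> 2 * (x\<^sup>2 + y\<^sup>2)" for x y :: real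
  using sum_squares_bound[of x y] by (simp add: power2_sum)

lemma sq_int_lincomb:
  assumes "sq_int f" "sq_int g"
  shows "sq_int (\<lambda>x. \<alpha> * f x + \<beta> * g x)"
proof -
  have [measurable]: "f \<in> borel_measurable borel" "g \<in> borel_measurable borel"
    using assms by (auto simp: sq_int_def)
  have "integrable lborel (\<lambda>x. (\<alpha> * f x + \<beta> * g x)\<^sup>2)"
  proof (rule Bochner_Integration.integrable_bound)
    show "integrable lborel (\<lambda>x. 2 * ((\<alpha> * f x)\<^sup>2 + (\<beta> * g x)\<^sup>2))"
      using assms unfolding sq_int_def by (auto simp: power_mult_distrib)
    show "AE x in lborel. norm ((\<alpha> * f x + \<beta> * g x)\<^sup>2) \<le> norm (2 * ((\<alpha> * f x)\<^sup>2 + (\<beta> * g x)\<^sup>2))"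
      using power2_sum_le[of "\<alpha> * f x" "\<beta> * g x" for x] by simp
  qed simp
  then show ?thesis
    by (simp add: sq_int_def)
qed

lemma integrable_sq_int_mult:
  assumes f: "sq_int f" and g: "sq_int g"
  shows "integrable lborel (\<lambda>x. f x * g x)"
proof -
  have "integrable lborel (\<lambda>x. ((1 * f x + 1 * g x)\<^sup>2 - (f x)\<^sup>2 - (g x)\<^sup>2) / 2)"
    using f g sq_int_lincomb[OF f g, of 1 1] unfolding sq_int_def by auto
  then show ?thesis
    by (simp add: power2_sum)
qed

lemma set_integrable_abs_sq_int:
  assumes "sq_int f"
  shows "set_integrable lborel {a..b} (\<lambda>t. \<bar>f t\<bar>)"
  using sq_int_imp_loc_integrable[OF assms] unfolding loc_integrable_def
  by (intro set_integrable_abs) blast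

lemma unit_interval_const:
  fixes c x :: real
  shows "set_integrable lborel {x..x+1} (\<lambda>_. c)" "(LINT t:{x..x+1}|lborel. c) = c"
  by (auto simp: set_integrable_def set_integral_const)

lemma square_integral_unit_interval_le:
  assumes f: "sq_int f"
  shows "(LINT t:{x..x+1}|lborel. \<bar>f t\<bar>)\<^sup>2 \<le> (LINT t|lborel. (f t)\<^sup>2)"
proof -
  let ?S = "{x..x+1}" and ?m = "LINT t:{x..x+1}|lborel. \<bar>f t\<bar>"
  have f2: "integrable lborel (\<lambda>t. (f t)\<^sup>2)"
    using f by (simp add: sq_int_def)
  then have f2_S: "set_integrable lborel ?S (\<lambda>t. (f t)\<^sup>2)"
    unfolding set_integrable_def by (intro integrable_mult_indicator) simp
  have "0 \<le> (LINT t:?S|lborel. (\<bar>f t\<bar> - ?m)\<^sup>2)"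
    by (simp add: set_lebesgue_integral_def integral_nonneg_AE)
  also have "\<dots> = (LINT t:?S|lborel. (f t)\<^sup>2 - 2 * ?m * \<bar>f t\<bar> + ?m\<^sup>2)"
    by (simp add: power2_diff mult_ac add_diff_eq diff_add_eq)
  also have "\<dots> = (LINT t:?S|lborel. (f t)\<^sup>2) - ?m\<^sup>2"
    using set_integrable_abs_sq_int[OF f] f2_S unit_interval_const
    by (simp add: set_integral_add set_integral_diff power2_eq_square)
  also have "(LINT t:?S|lborel. (f t)\<^sup>2) \<le> (LINT t|lborel. (f t)\<^sup>2)"
    unfolding set_lebesgue_integral_def using f2 f2_S
    by (intro integral_mono) (auto simp: set_integrable_def indicator_def)
  finally show ?thesis
    by simp
qed

lemma weak_deriv_AE_abs_le:
  assumes w: "weak_deriv u u'" and u: "sq_int u" and u': "sq_int u'"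
  shows "AE x in lborel. \<bar>u x\<bar> \<le> (LINT t:{x..x+1}|lborel. \<bar>u t\<bar>) + (LINT t:{x..x+1}|lborel. \<bar>u' t\<bar>)"
  using weak_deriv_FTC[OF w]
proof eventually_elim
  case (elim x)
  let ?S = "{x..x+1}" and ?m' = "LINT t:{x..x+1}|lborel. \<bar>u' t\<bar>"
  note integrable_abs = set_integrable_abs_sq_int[OF u] set_integrable_abs_sq_int[OF u']
  have increment: "\<bar>LINT t:{x..y}|lborel. u' t\<bar> \<le> ?m'" if "y \<in> ?S" for y
  proof -
    have "\<bar>LINT t:{x..y}|lborel. u' t\<bar> \<le> (LINT t:{x..y}|lborel. \<bar>u' t\<bar>)"
      using integral_abs_bound[of lborel "\<lambda>t. indicator {x..y} t *\<^sub>R u' t"]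
      by (simp add: set_lebesgue_integral_def abs_mult)
    also have "\<dots> \<le> ?m'"
      using that integrable_abs(2) unfolding set_lebesgue_integral_def set_integrable_def
      by (intro integral_mono) (auto simp: indicator_def)
    finally show ?thesis .
  qed
  have "\<bar>u x\<bar> = (LINT y:?S|lborel. \<bar>u x\<bar>)"
    by (simp only: unit_interval_const)
  also have "\<dots> \<le> (LINT y:?S|lborel. \<bar>u y\<bar> + ?m')"
  proof (rule set_integral_mono_AE)
    show "AE y\<in>?S in lborel. \<bar>u x\<bar> \<le> \<bar>u y\<bar> + ?m'"
      using elim
    proof eventually_elim
      case (elim y)
      then show ?case
        using increment[of y] by auto
    qed
  qed (intro set_integral_add integrable_abs unit_interval_const)+
  also have "\<dots> = (LINT t:?S|lborel. \<bar>u t\<bar>) + ?m'"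
    using integrable_abs(1) unit_interval_const by (simp add: set_integral_add)
  finally show ?case .
qed

lemma weak_deriv_AE_bounded:
  assumes w: "weak_deriv u u'" and u: "sq_int u" and u': "sq_int u'"
  shows "AE x in lborel. (u x)\<^sup>2 \<le> 2 * ((LINT t|lborel. (u t)\<^sup>2) + (LINT t|lborel. (u' t)\<^sup>2))"
  using weak_deriv_AE_abs_le[OF assms]
proof eventually_elim
  case (elim x)
  let ?m = "\<lambda>f. LINT t:{x..x+1}|lborel. \<bar>f t\<bar>"
  have "(u x)\<^sup>2 \<le> (?m u + ?m u')\<^sup>2"
    using elim by (intro abs_le_square_iff[THEN iffD1]) auto
  also have "\<dots> \<le> 2 * ((?m u)\<^sup>2 + (?m u')\<^sup>2)"
    by (rule power2_sum_le)
  finally show ?case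
    using square_integral_unit_interval_le[OF u, of x] square_integral_unit_interval_le[OF u', of x]
    by simp
qed

lemma wd_weak_deriv:
  assumes "weak_deriv u u'"
  shows "weak_deriv u (wd u)" "AE x in lborel. wd u x = u' x"
proof -
  show "weak_deriv u (wd u)"
    unfolding wd_def using assms by (rule someI[of "weak_deriv u"])
  then show "AE x in lborel. wd u x = u' x"
    using assms weak_deriv_unique by blast
qed

lemma wd_wd_weak_deriv:
  assumes u: "weak_deriv u u1" and u1: "weak_deriv u1 u2"
  shows "weak_deriv (wd u) (wd (wd u))" "AE x in lborel. wd (wd u) x = u2 x"
proof -
  have "AE x in lborel. u1 x = wd u x"
    using wd_weak_deriv(2)[OF u] by (auto elim: eventually_mono)
  then have "weak_deriv (wd u) u2"
    using weak_deriv_cong_AE[OF u1] loc_integrable_imp_borel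
      weak_deriv_loc_integrable(2)[OF wd_weak_deriv(1)[OF u]]
    by blast
  then show "weak_deriv (wd u) (wd (wd u))" "AE x in lborel. wd (wd u) x = u2 x"
    by (rule wd_weak_deriv)+
qed

lemma sq_int_cong_AE:
  assumes f: "sq_int f" and eq: "AE x in lborel. g x = f x" and g: "g \<in> borel_measurable borel"
  shows "sq_int g"
proof -
  have "integrable lborel (\<lambda>x. (g x)\<^sup>2) \<longleftrightarrow> integrable lborel (\<lambda>x. (f x)\<^sup>2)"
    using f g eq by (intro integrable_cong_AE) (auto simp: sq_int_def elim: eventually_mono)
  with f g show ?thesis
    by (simp add: sq_int_def)
qed

lemma H2D:
  assumes "H2 u"
  shows "sq_int u" "sq_int (wd u)" "sq_int (wd (wd u))"
    and "weak_deriv u (wd u)" "weak_deriv (wd u) (wd (wd u))"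
proof -
  obtain u1 u2 where u: "sq_int u" "sq_int u1" "sq_int u2"
    and w: "weak_deriv u u1" "weak_deriv u1 u2"
    using assms unfolding H2_def by blast
  note wd = wd_weak_deriv[OF w(1)] wd_wd_weak_deriv[OF w]
  show "sq_int u" "weak_deriv u (wd u)" "weak_deriv (wd u) (wd (wd u))"
    using u(1) wd by auto
  show "sq_int (wd u)" "sq_int (wd (wd u))"
    using u(2,3) wd loc_integrable_imp_borel[OF weak_deriv_loc_integrable(2)]
    by (auto intro: sq_int_cong_AE)
qed

lemma H2_lincomb:
  assumes "H2 u" "H2 v"
  shows "H2 (\<lambda>x. \<alpha> * u x + \<beta> * v x)"
    and "AE x in lborel. wd (\<lambda>x. \<alpha> * u x + \<beta> * v x) x = \<alpha> * wd u x + \<beta> * wd v x"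
    and "AE x in lborel. wd (wd (\<lambda>x. \<alpha> * u x + \<beta> * v x)) x = \<alpha> * wd (wd u) x + \<beta> * wd (wd v) x"
proof -
  let ?w = "\<lambda>x. \<alpha> * u x + \<beta> * v x"
  note u = H2D[OF assms(1)] and v = H2D[OF assms(2)]
  note w1 = weak_deriv_lincomb[OF u(4) v(4), of \<alpha> \<beta>]
    and w2 = weak_deriv_lincomb[OF u(5) v(5), of \<alpha> \<beta>]
  show "H2 ?w"
    unfolding H2_def using w1 w2 u v sq_int_lincomb by blast
  show "AE x in lborel. wd ?w x = \<alpha> * wd u x + \<beta> * wd v x"
    by (rule wd_weak_deriv(2)[OF w1])
  show "AE x in lborel. wd (wd ?w) x = \<alpha> * wd (wd u) x + \<beta> * wd (wd v) x"
    by (rule wd_wd_weak_deriv(2)[OF w1 w2])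
qed

section \<open>Energy functionals\<close>

text \<open>Only the first component of a state is assumed essentially bounded: it will hold the
  derivatives controlled by the Sobolev embedding, the second one the derivatives of top order.\<close>

definition energy_space :: "'m measure \<Rightarrow> ('m \<Rightarrow> 'a::euclidean_space \<times> 'b::euclidean_space) set" where
  "energy_space M = {Z \<in> borel_measurable M. integrable M (\<lambda>x. (norm (Z x))\<^sup>2) \<and>
     (\<exists>R. AE x in M. norm (fst (Z x)) \<le> R)}"

lemma energy_space_measurable: "Z \<in> energy_space M \<Longrightarrow> Z \<in> borel_measurable M"
  by (simp add: energy_space_def)

lemma energy_space_integrable: "Z \<in> energy_space M \<Longrightarrow> integrable M (\<lambda>x. (norm (Z x))\<^sup>2)"
  by (simp add: energy_space_def)

lemma energy_space_bounded:
  assumes "Z \<in> energy_space M"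
  obtains R where "R \<ge> 0" "AE x in M. norm (fst (Z x)) \<le> R"
proof -
  obtain R where "AE x in M. norm (fst (Z x)) \<le> R"
    using assms unfolding energy_space_def by blast
  then have "AE x in M. norm (fst (Z x)) \<le> \<bar>R\<bar>"
    by eventually_elim linarith
  then show thesis
    using that[of "\<bar>R\<bar>"] by simp
qed

lemma energy_space_bounded_both:
  assumes "Z \<in> energy_space M" "Y \<in> energy_space M"
  obtains R where "AE x in M. norm (fst (Z x)) \<le> R" "AE x in M. norm (fst (Y x)) \<le> R"
proof -
  obtain R1 R2 where R: "AE x in M. norm (fst (Z x)) \<le> R1" "AE x in M. norm (fst (Y x)) \<le> R2"
    using assms unfolding energy_space_def by blast
  show thesis
  proof (rule that)
    show "AE x in M. norm (fst (Z x)) \<le> max R1 R2"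
      using R(1) by eventually_elim simp
    show "AE x in M. norm (fst (Y x)) \<le> max R1 R2"
      using R(2) by eventually_elim simp
  qed
qed

lemma AE_norm_fst_scaleR_le:
  assumes "AE x in M. norm (fst (Z x)) \<le> R" "\<bar>r\<bar> \<le> c"
  shows "AE x in M. norm (fst (r *\<^sub>R Z x)) \<le> c * R"
  using assms(1)
proof eventually_elim
  case (elim x)
  with assms(2) show ?case
    using mult_mono[of "\<bar>r\<bar>" c "norm (fst (Z x))" R] by simp
qed

lemma norm_lincomb_le: "norm (\<alpha> *\<^sub>R z + \<beta> *\<^sub>R y) \<le> \<bar>\<alpha>\<bar> * norm z + \<bar>\<beta>\<bar> * norm y"
  using norm_triangle_ineq[of "\<alpha> *\<^sub>R z" "\<beta> *\<^sub>R y"] by simp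

lemma energy_space_lincomb:
  assumes Z: "Z \<in> energy_space M" and Y: "Y \<in> energy_space M"
  shows "(\<lambda>x. \<alpha> *\<^sub>R Z x + \<beta> *\<^sub>R Y x) \<in> energy_space M"
proof -
  have m: "(\<lambda>x. \<alpha> *\<^sub>R Z x + \<beta> *\<^sub>R Y x) \<in> borel_measurable M"
    using Z Y by (auto simp: energy_space_def)
  moreover have "integrable M (\<lambda>x. (norm (\<alpha> *\<^sub>R Z x + \<beta> *\<^sub>R Y x))\<^sup>2)"
  proof (rule Bochner_Integration.integrable_bound)
    show "integrable M (\<lambda>x. 2 * ((\<bar>\<alpha>\<bar> * norm (Z x))\<^sup>2 + (\<bar>\<beta>\<bar> * norm (Y x))\<^sup>2))"
      using Z Y by (simp add: power_mult_distrib energy_space_integrable)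
    have "(norm (\<alpha> *\<^sub>R z + \<beta> *\<^sub>R y))\<^sup>2 \<le> 2 * ((\<bar>\<alpha>\<bar> * norm z)\<^sup>2 + (\<bar>\<beta>\<bar> * norm y)\<^sup>2)"
      for z y :: "'b \<times> 'c"
      by (rule order_trans[OF power_mono[OF norm_lincomb_le] power2_sum_le]) simp
    then show "AE x in M. norm ((norm (\<alpha> *\<^sub>R Z x + \<beta> *\<^sub>R Y x))\<^sup>2)
        \<le> norm (2 * ((\<bar>\<alpha>\<bar> * norm (Z x))\<^sup>2 + (\<bar>\<beta>\<bar> * norm (Y x))\<^sup>2))"
      by (simp add: abs_of_nonneg)
  qed (use m in measurable)
  moreover obtain R S where "AE x in M. norm (fst (Z x)) \<le> R" "AE x in M. norm (fst (Y x)) \<le> S"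
    using Z Y energy_space_bounded by metis
  then have "AE x in M. norm (fst (\<alpha> *\<^sub>R Z x + \<beta> *\<^sub>R Y x)) \<le> \<bar>\<alpha>\<bar> * R + \<bar>\<beta>\<bar> * S"
  proof eventually_elim
    case (elim x)
    have "norm (fst (\<alpha> *\<^sub>R Z x + \<beta> *\<^sub>R Y x)) \<le> \<bar>\<alpha>\<bar> * norm (fst (Z x)) + \<bar>\<beta>\<bar> * norm (fst (Y x))"
      using norm_lincomb_le[of \<alpha> "fst (Z x)" \<beta> "fst (Y x)"] by simp
    also have "\<dots> \<le> \<bar>\<alpha>\<bar> * R + \<bar>\<beta>\<bar> * S"
      using elim by (intro add_mono mult_left_mono) auto
    finally show ?case .
  qed
  ultimately show ?thesis
    unfolding energy_space_def by blast
qed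

lemma energy_space_scaleR:
  assumes "Z \<in> energy_space M"
  shows "(\<lambda>x. t *\<^sub>R Z x) \<in> energy_space M"
  using energy_space_lincomb[OF assms assms, of t 0] by simp

lemma energy_space_add:
  assumes "Z \<in> energy_space M" "Y \<in> energy_space M"
  shows "(\<lambda>x. Z x + Y x) \<in> energy_space M"
  using energy_space_lincomb[OF assms, of 1 1] by simp

lemma energy_space_diff:
  assumes "Z \<in> energy_space M" "Y \<in> energy_space M"
  shows "(\<lambda>x. Z x - Y x) \<in> energy_space M"
  using energy_space_lincomb[OF assms, of 1 "- 1"] by simp

lemma integrable_norm_mult:
  assumes Z: "Z \<in> energy_space M" and Y: "Y \<in> energy_space M"
  shows "integrable M (\<lambda>x. norm (Z x) * norm (Y x))"
proof (rule Bochner_Integration.integrable_bound)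
  show "integrable M (\<lambda>x. (norm (Z x))\<^sup>2 + (norm (Y x))\<^sup>2)"
    using Z Y by (simp add: energy_space_integrable)
  show "(\<lambda>x. norm (Z x) * norm (Y x)) \<in> borel_measurable M"
    using energy_space_measurable[OF Z] energy_space_measurable[OF Y] by measurable
  have "s * t \<le> s\<^sup>2 + t\<^sup>2" for s t :: real
    using sum_squares_bound[of s t] zero_le_power2[of s] zero_le_power2[of t] by linarith
  then show "AE x in M. norm (norm (Z x) * norm (Y x)) \<le> norm ((norm (Z x))\<^sup>2 + (norm (Y x))\<^sup>2)"
    by (simp add: abs_of_nonneg)
qed

lemma DERIV_quadratic_remainder:
  fixes f :: "real \<Rightarrow> real"
  assumes "\<And>h. \<bar>h\<bar> \<le> 1 \<Longrightarrow> \<bar>f (x + h) - f x - h * D\<bar> \<le> C * h\<^sup>2"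
  shows "(f has_real_derivative D) (at x)"
  unfolding DERIV_def
proof (rule LIM_zero_cancel, rule Lim_null_comparison)
  show "((\<lambda>h. C * \<bar>h\<bar>) \<longlongrightarrow> 0) (at 0)"
    by (auto intro!: tendsto_eq_intros)
  have "\<bar>(f (x + h) - f x) / h - D\<bar> \<le> C * \<bar>h\<bar>" if "h \<noteq> 0" "\<bar>h\<bar> \<le> 1" for h
  proof -
    have "(f (x + h) - f x) / h - D = (f (x + h) - f x - h * D) / h"
      using that(1) by (simp add: diff_divide_distrib)
    then have "\<bar>(f (x + h) - f x) / h - D\<bar> \<le> C * h\<^sup>2 / \<bar>h\<bar>"
      using divide_right_mono[OF assms[OF that(2)] abs_ge_zero[of h]] by (simp flip: abs_divide)
    also have "\<dots> = C * \<bar>h\<bar>"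
      using that(1) by (cases "h < 0") (auto simp: power2_eq_square)
    finally show ?thesis .
  qed
  then show "\<forall>\<^sub>F h in at 0. norm ((f (x + h) - f x) / h - D) \<le> C * \<bar>h\<bar>"
    unfolding eventually_at by (intro exI[of _ 1]) (auto simp: dist_real_def)
qed

locale energy_functional =
  fixes M :: "'m measure"
    and j :: "'a::euclidean_space \<times> 'b::euclidean_space \<Rightarrow> real"
    and dj :: "'a \<times> 'b \<Rightarrow> 'a \<times> 'b \<Rightarrow> real"
  assumes j_has_derivative: "(j has_derivative dj z) (at z)"
    and j_0: "j 0 = 0" and dj_0: "dj 0 y = 0"
    and dj_Lipschitz: "\<exists>C\<ge>0. \<forall>z z' y. norm (fst z) \<le> R \<longrightarrow> norm (fst z') \<le> R \<longrightarrow>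
      \<bar>dj z y - dj z' y\<bar> \<le> C * norm (z - z') * norm y"
begin

definition energy :: "('m \<Rightarrow> 'a \<times> 'b) \<Rightarrow> real" where
  "energy Z = (LINT x|M. j (Z x))"

definition energy_deriv :: "('m \<Rightarrow> 'a \<times> 'b) \<Rightarrow> ('m \<Rightarrow> 'a \<times> 'b) \<Rightarrow> real" where
  "energy_deriv Z Y = (LINT x|M. dj (Z x) (Y x))"

definition lipschitz_constant :: "real \<Rightarrow> real" where
  "lipschitz_constant R = (SOME C. C \<ge> 0 \<and> (\<forall>z z' y. norm (fst z) \<le> R \<longrightarrow> norm (fst z') \<le> R \<longrightarrow>
      \<bar>dj z y - dj z' y\<bar> \<le> C * norm (z - z') * norm y))"

lemma lipschitz_constant_nonneg: "0 \<le> lipschitz_constant R"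
  and lipschitz_constant: "norm (fst z) \<le> R \<Longrightarrow> norm (fst z') \<le> R \<Longrightarrow>
    \<bar>dj z y - dj z' y\<bar> \<le> lipschitz_constant R * norm (z - z') * norm y"
  using someI_ex[OF dj_Lipschitz[of R]] unfolding lipschitz_constant_def by blast+

lemma dj_bound:
  assumes "norm (fst z) \<le> R"
  shows "\<bar>dj z y\<bar> \<le> lipschitz_constant R * norm z * norm y"
  using lipschitz_constant[of z R 0 y] assms order_trans[OF norm_ge_zero assms] by (simp add: dj_0)

lemma linear_dj: "linear (dj z)"
  by (rule has_derivative_linear[OF j_has_derivative])

lemma energy_deriv_scaleR: "energy_deriv Z (\<lambda>x. t *\<^sub>R Y x) = t * energy_deriv Z Y"
  by (simp add: energy_deriv_def linear_scale[OF linear_dj])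

lemma continuous_on_j: "continuous_on UNIV j"
  by (rule has_derivative_continuous_on) (use j_has_derivative in auto)

lemma DERIV_j_line: "((\<lambda>s. j (z + s *\<^sub>R y)) has_real_derivative dj (z + s *\<^sub>R y) y) (at s)"
  unfolding has_field_derivative_def
  by (rule has_derivative_eq_rhs[OF has_derivative_compose[OF _ j_has_derivative]])
    (auto intro!: derivative_eq_intros simp: linear_scale[OF linear_dj] fun_eq_iff)

lemma j_linearisation:
  assumes z0: "norm (fst z0) \<le> R" and z: "norm (fst z) \<le> R" and y: "norm (fst y) \<le> R"
  shows "\<bar>j (z + y) - j z - dj z0 y\<bar>
    \<le> lipschitz_constant (2 * R) * (norm y * norm (z - z0) + (norm y)\<^sup>2)"
proof -
  obtain u where u: "0 < u" "u < 1" "j (z + y) - j z = dj (z + u *\<^sub>R y) y"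
    using MVT2[of 0 1 "\<lambda>s. j (z + s *\<^sub>R y)" "\<lambda>s. dj (z + s *\<^sub>R y) y"] DERIV_j_line by auto
  have shrink: "u * r \<le> r" if "0 \<le> r" for r :: real
    using u(2) that mult_right_mono[of u 1 r] by simp
  have "norm (fst (z + u *\<^sub>R y)) \<le> norm (fst z) + u * norm (fst y)"
    using u(1) norm_triangle_ineq[of "fst z" "u *\<^sub>R fst y"] by simp
  also have "\<dots> \<le> 2 * R"
    using z y shrink[of "norm (fst y)"] by simp
  finally have "\<bar>dj (z + u *\<^sub>R y) y - dj z0 y\<bar>
      \<le> lipschitz_constant (2 * R) * norm (z + u *\<^sub>R y - z0) * norm y"
    using z0 order_trans[OF norm_ge_zero z0] by (intro lipschitz_constant) auto
  also have "\<dots> \<le> lipschitz_constant (2 * R) * (norm (z - z0) + norm y) * norm y"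
  proof (intro mult_right_mono mult_left_mono lipschitz_constant_nonneg norm_ge_zero)
    have "norm (z + u *\<^sub>R y - z0) \<le> norm (z - z0) + u * norm y"
      using u(1) norm_triangle_ineq[of "z - z0" "u *\<^sub>R y"] by (simp add: algebra_simps)
    also have "\<dots> \<le> norm (z - z0) + norm y"
      using shrink[of "norm y"] by simp
    finally show "norm (z + u *\<^sub>R y - z0) \<le> norm (z - z0) + norm y" .
  qed
  finally show ?thesis
    unfolding u(3) by (simp add: power2_eq_square algebra_simps)
qed

lemma integrable_energy:
  assumes Z: "Z \<in> energy_space M"
  shows "integrable M (\<lambda>x. j (Z x))"
proof -
  obtain R where R: "R \<ge> 0" "AE x in M. norm (fst (Z x)) \<le> R"
    using energy_space_bounded[OF Z] .
  show ?thesis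
  proof (rule Bochner_Integration.integrable_bound)
    show "integrable M (\<lambda>x. lipschitz_constant (2 * R) * (norm (Z x))\<^sup>2)"
      using Z by (simp add: energy_space_integrable)
    show "(\<lambda>x. j (Z x)) \<in> borel_measurable M"
      by (rule borel_measurable_continuous_on[OF continuous_on_j energy_space_measurable[OF Z]])
    show "AE x in M. norm (j (Z x)) \<le> norm (lipschitz_constant (2 * R) * (norm (Z x))\<^sup>2)"
      using R(2)
    proof eventually_elim
      case (elim x)
      then show ?case
        using j_linearisation[of 0 R 0 "Z x"] R(1) lipschitz_constant_nonneg by (simp add: j_0 dj_0)
    qed
  qed
qed

lemma energy_deriv_measurable:
  assumes Z: "Z \<in> energy_space M" and Y: "Y \<in> energy_space M"
  shows "(\<lambda>x. dj (Z x) (Y x)) \<in> borel_measurable M"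
proof (rule borel_measurable_LIMSEQ_metric)
  let ?\<sigma> = "\<lambda>n. inverse (real (Suc n))"
  have [measurable]: "Z \<in> borel_measurable M" "Y \<in> borel_measurable M" "j \<in> borel_measurable borel"
    using energy_space_measurable[OF Z] energy_space_measurable[OF Y]
      borel_measurable_continuous_onI[OF continuous_on_j] by auto
  show "(\<lambda>x. (j (Z x + ?\<sigma> n *\<^sub>R Y x) - j (Z x)) / ?\<sigma> n) \<in> borel_measurable M" for n
    by measurable
  show "(\<lambda>n. (j (Z x + ?\<sigma> n *\<^sub>R Y x) - j (Z x)) / ?\<sigma> n) \<longlonglongrightarrow> dj (Z x) (Y x)" for x
  proof -
    have "((\<lambda>s. (j (Z x + s *\<^sub>R Y x) - j (Z x)) / s) \<longlongrightarrow> dj (Z x) (Y x)) (at 0)"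
      using DERIV_j_line[of "Z x" "Y x" 0] by (simp add: has_field_derivative_iff)
    then show ?thesis
      by (rule filterlim_compose)
        (use LIMSEQ_inverse_real_of_nat in \<open>simp add: filterlim_at\<close>)
  qed
qed

lemma integrable_energy_deriv:
  assumes Z: "Z \<in> energy_space M" and Y: "Y \<in> energy_space M"
  shows "integrable M (\<lambda>x. dj (Z x) (Y x))"
proof -
  obtain R where R: "AE x in M. norm (fst (Z x)) \<le> R"
    using energy_space_bounded[OF Z] by blast
  show ?thesis
  proof (rule Bochner_Integration.integrable_bound)
    show "integrable M (\<lambda>x. lipschitz_constant R * (norm (Z x) * norm (Y x)))"
      using integrable_norm_mult[OF Z Y] by simp
    show "(\<lambda>x. dj (Z x) (Y x)) \<in> borel_measurable M"
      by (rule energy_deriv_measurable[OF Z Y])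
    show "AE x in M. norm (dj (Z x) (Y x))
        \<le> norm (lipschitz_constant R * (norm (Z x) * norm (Y x)))"
      using R
    proof eventually_elim
      case (elim x)
      then show ?case
        using dj_bound[of "Z x" R "Y x"] lipschitz_constant_nonneg by (simp add: mult.assoc)
    qed
  qed
qed

lemma energy_cong_AE:
  assumes "Z \<in> energy_space M" "W \<in> energy_space M" and eq: "AE x in M. Z x = W x"
  shows "energy Z = energy W" and "energy_deriv Z Z = energy_deriv W W"
  unfolding energy_def energy_deriv_def
  using assms(1,2)[THEN integrable_energy] integrable_energy_deriv[OF assms(1,1)]
    integrable_energy_deriv[OF assms(2,2)] eq
  by (auto intro!: integral_cong_AE elim: eventually_mono)

lemma energy_linearisation:
  assumes Z0: "Z0 \<in> energy_space M" "AE x in M. norm (fst (Z0 x)) \<le> R"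
    and Z: "Z \<in> energy_space M" "AE x in M. norm (fst (Z x)) \<le> R"
    and Y: "Y \<in> energy_space M" "AE x in M. norm (fst (Y x)) \<le> R"
  shows "\<bar>energy (\<lambda>x. Z x + Y x) - energy Z - energy_deriv Z0 Y\<bar>
    \<le> lipschitz_constant (2 * R) *
      ((LINT x|M. norm (Y x) * norm (Z x - Z0 x)) + (LINT x|M. (norm (Y x))\<^sup>2))"
proof -
  note int = integrable_energy[OF energy_space_add[OF Z(1) Y(1)]] integrable_energy[OF Z(1)]
    integrable_energy_deriv[OF Z0(1) Y(1)]
  note int_bound = integrable_norm_mult[OF Y(1) energy_space_diff[OF Z(1) Z0(1)]]
    energy_space_integrable[OF Y(1)]
  have "\<bar>energy (\<lambda>x. Z x + Y x) - energy Z - energy_deriv Z0 Y\<bar>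
      = \<bar>LINT x|M. j (Z x + Y x) - j (Z x) - dj (Z0 x) (Y x)\<bar>"
    using int by (simp add: energy_def energy_deriv_def)
  also have "\<dots> \<le> (LINT x|M. \<bar>j (Z x + Y x) - j (Z x) - dj (Z0 x) (Y x)\<bar>)"
    by (rule integral_abs_bound)
  also have "\<dots> \<le> (LINT x|M. lipschitz_constant (2 * R) *
      (norm (Y x) * norm (Z x - Z0 x) + (norm (Y x))\<^sup>2))"
  proof (rule integral_mono_AE)
    show "AE x in M. \<bar>j (Z x + Y x) - j (Z x) - dj (Z0 x) (Y x)\<bar>
        \<le> lipschitz_constant (2 * R) * (norm (Y x) * norm (Z x - Z0 x) + (norm (Y x))\<^sup>2)"
      using Z0(2) Z(2) Y(2) by eventually_elim (rule j_linearisation)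
  qed (use int int_bound in auto)
  finally show ?thesis
    using int_bound by simp
qed

lemma energy_frechet_bound:
  assumes Z: "Z \<in> energy_space M"
  obtains C where "C \<ge> 0" "\<And>Y. Y \<in> energy_space M \<Longrightarrow> AE x in M. norm (fst (Y x)) \<le> 1 \<Longrightarrow>
    \<bar>energy (\<lambda>x. Z x + Y x) - energy Z - energy_deriv Z Y\<bar> \<le> C * (LINT x|M. (norm (Y x))\<^sup>2)"
proof -
  obtain R where R: "R \<ge> 0" "AE x in M. norm (fst (Z x)) \<le> R"
    using energy_space_bounded[OF Z] .
  have Z_bound: "AE x in M. norm (fst (Z x)) \<le> R + 1"
    using R(2) by eventually_elim simp
  show thesis
  proof (rule that[OF lipschitz_constant_nonneg])
    fix Y :: "'m \<Rightarrow> 'a \<times> 'b" assume Y: "Y \<in> energy_space M" "AE x in M. norm (fst (Y x)) \<le> 1"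
    have "AE x in M. norm (fst (Y x)) \<le> R + 1"
      using Y(2) by eventually_elim (use R(1) in simp)
    then show "\<bar>energy (\<lambda>x. Z x + Y x) - energy Z - energy_deriv Z Y\<bar>
        \<le> lipschitz_constant (2 * (R + 1)) * (LINT x|M. (norm (Y x))\<^sup>2)"
      using energy_linearisation[OF Z Z_bound Z Z_bound Y(1)] by simp
  qed
qed

lemma energy_plane_linearisation:
  assumes Z: "Z \<in> energy_space M" and Y: "Y \<in> energy_space M"
  obtains C where "C \<ge> 0" "\<And>t s. \<bar>t - 1\<bar> \<le> 1 \<Longrightarrow> \<bar>s\<bar> \<le> 1 \<Longrightarrow>
    \<bar>energy (\<lambda>x. t *\<^sub>R Z x + s *\<^sub>R Y x) - energy (\<lambda>x. t *\<^sub>R Z x) - s * energy_deriv Z Y\<bar>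
      \<le> C * (\<bar>s\<bar> * (\<bar>t - 1\<bar> + \<bar>s\<bar>))"
proof -
  obtain R where R: "AE x in M. norm (fst (Z x)) \<le> R" "AE x in M. norm (fst (Y x)) \<le> R"
    using energy_space_bounded_both[OF Z Y] by blast
  let ?L = "lipschitz_constant (2 * (2 * R))"
  define A B where "A = (LINT x|M. norm (Y x) * norm (Z x))" and "B = (LINT x|M. (norm (Y x))\<^sup>2)"
  have AB_nonneg: "0 \<le> A" "0 \<le> B"
    by (simp_all add: A_def B_def integral_nonneg_AE)
  show thesis
  proof (rule that[of "?L * (A + B)"])
    show "0 \<le> ?L * (A + B)"
      using lipschitz_constant_nonneg AB_nonneg by simp
    fix t s :: real assume ts: "\<bar>t - 1\<bar> \<le> 1" "\<bar>s\<bar> \<le> 1"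
    have Z_bound: "AE x in M. norm (fst (Z x)) \<le> 2 * R"
      using AE_norm_fst_scaleR_le[OF R(1), of 1 2] by simp
    have tZ_bound: "AE x in M. norm (fst (t *\<^sub>R Z x)) \<le> 2 * R"
      using ts(1) by (intro AE_norm_fst_scaleR_le R) (simp add: abs_le_iff)
    have sY_bound: "AE x in M. norm (fst (s *\<^sub>R Y x)) \<le> 2 * R"
      using ts(2) by (intro AE_norm_fst_scaleR_le R) simp
    note lin = energy_linearisation[OF Z Z_bound energy_space_scaleR[OF Z] tZ_bound
      energy_space_scaleR[OF Y] sY_bound]
    have cross: "norm (s *\<^sub>R Y x) * norm (t *\<^sub>R Z x - Z x)
        = \<bar>s\<bar> * \<bar>t - 1\<bar> * (norm (Y x) * norm (Z x))" for x
      using norm_scaleR[of "t - 1" "Z x"] by (simp add: scaleR_diff_left)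
    have "(LINT x|M. norm (s *\<^sub>R Y x) * norm (t *\<^sub>R Z x - Z x)) + (LINT x|M. (norm (s *\<^sub>R Y x))\<^sup>2)
        = \<bar>s\<bar> * \<bar>t - 1\<bar> * A + s\<^sup>2 * B"
      unfolding cross by (simp add: A_def B_def power_mult_distrib)
    also have "\<dots> \<le> \<bar>s\<bar> * \<bar>t - 1\<bar> * (A + B) + s\<^sup>2 * (A + B)"
      using AB_nonneg by (intro add_mono mult_left_mono) auto
    also have "\<dots> = (A + B) * (\<bar>s\<bar> * (\<bar>t - 1\<bar> + \<bar>s\<bar>))"
      by (simp add: power2_eq_square algebra_simps)
    finally show "\<bar>energy (\<lambda>x. t *\<^sub>R Z x + s *\<^sub>R Y x) - energy (\<lambda>x. t *\<^sub>R Z x)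
        - s * energy_deriv Z Y\<bar>
        \<le> ?L * (A + B) * (\<bar>s\<bar> * (\<bar>t - 1\<bar> + \<bar>s\<bar>))"
      using lin mult_left_mono[OF _ lipschitz_constant_nonneg, of _ _ "2 * (2 * R)"]
      by (fastforce simp: energy_deriv_scaleR mult.assoc)
  qed
qed

lemma DERIV_energy_line:
  assumes Z: "Z \<in> energy_space M" and Y: "Y \<in> energy_space M"
  shows "((\<lambda>s. energy (\<lambda>x. Z x + s *\<^sub>R Y x)) has_real_derivative energy_deriv Z Y) (at 0)"
proof -
  obtain C where C: "\<And>t s. \<bar>t - 1\<bar> \<le> 1 \<Longrightarrow> \<bar>s\<bar> \<le> 1 \<Longrightarrow>
      \<bar>energy (\<lambda>x. t *\<^sub>R Z x + s *\<^sub>R Y x) - energy (\<lambda>x. t *\<^sub>R Z x) - s * energy_deriv Z Y\<bar>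
        \<le> C * (\<bar>s\<bar> * (\<bar>t - 1\<bar> + \<bar>s\<bar>))"
    by (rule energy_plane_linearisation[OF Z Y]) blast
  show ?thesis
  proof (rule DERIV_quadratic_remainder)
    show "\<bar>energy (\<lambda>x. Z x + (0 + s) *\<^sub>R Y x) - energy (\<lambda>x. Z x + 0 *\<^sub>R Y x) - s * energy_deriv Z Y\<bar>
        \<le> C * s\<^sup>2"
      if "\<bar>s\<bar> \<le> 1" for s
      using C[of 1 s] that by (simp add: power2_eq_square)
  qed
qed

lemma DERIV_energy_ray:
  assumes W: "W \<in> energy_space M"
  shows "((\<lambda>t. energy (\<lambda>x. t *\<^sub>R W x)) has_real_derivative energy_deriv (\<lambda>x. t *\<^sub>R W x) W) (at t)"
  using DERIV_energy_line[OF energy_space_scaleR[OF W] W, of t]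
    DERIV_shift[of "\<lambda>t. energy (\<lambda>x. t *\<^sub>R W x)" _ 0 t]
  by (simp add: scaleR_add_left add.commute)

lemma energy_descent:
  assumes Z: "Z \<in> energy_space M" and Y: "Y \<in> energy_space M" and neg: "energy_deriv Z Y < 0"
  obtains \<epsilon> where "0 < \<epsilon>" "\<And>t s. \<bar>t - 1\<bar> \<le> \<epsilon> \<Longrightarrow> 0 < s \<Longrightarrow> s \<le> \<epsilon> \<Longrightarrow>
    energy (\<lambda>x. t *\<^sub>R Z x + s *\<^sub>R Y x) < energy (\<lambda>x. t *\<^sub>R Z x)"
proof -
  obtain C where C: "C \<ge> 0" "\<And>t s. \<bar>t - 1\<bar> \<le> 1 \<Longrightarrow> \<bar>s\<bar> \<le> 1 \<Longrightarrow>
      \<bar>energy (\<lambda>x. t *\<^sub>R Z x + s *\<^sub>R Y x) - energy (\<lambda>x. t *\<^sub>R Z x) - s * energy_deriv Z Y\<bar>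
        \<le> C * (\<bar>s\<bar> * (\<bar>t - 1\<bar> + \<bar>s\<bar>))"
    by (rule energy_plane_linearisation[OF Z Y]) blast
  define \<epsilon> where "\<epsilon> = min 1 (- energy_deriv Z Y / (2 * C + 1) / 2)"
  have \<epsilon>: "0 < \<epsilon>" "\<epsilon> \<le> 1" "(2 * C + 1) * \<epsilon> < - energy_deriv Z Y"
  proof -
    show "0 < \<epsilon>" "\<epsilon> \<le> 1"
      using C(1) neg by (auto simp: \<epsilon>_def intro!: divide_neg_pos)
    have "(2 * C + 1) * \<epsilon> \<le> (2 * C + 1) * (- energy_deriv Z Y / (2 * C + 1) / 2)"
      using C(1) by (intro mult_left_mono) (auto simp: \<epsilon>_def)
    also have "\<dots> = - energy_deriv Z Y / 2"
      using C(1) by (simp add: divide_simps)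
    finally show "(2 * C + 1) * \<epsilon> < - energy_deriv Z Y"
      using neg by simp
  qed
  show thesis
  proof (rule that[OF \<epsilon>(1)])
    fix t s :: real assume ts: "\<bar>t - 1\<bar> \<le> \<epsilon>" "0 < s" "s \<le> \<epsilon>"
    have "C * (s * (\<bar>t - 1\<bar> + s)) \<le> C * (s * (\<epsilon> + \<epsilon>))"
      using ts C(1) by (intro mult_left_mono add_mono) auto
    then have "energy (\<lambda>x. t *\<^sub>R Z x + s *\<^sub>R Y x) - energy (\<lambda>x. t *\<^sub>R Z x)
        \<le> s * (energy_deriv Z Y + 2 * C * \<epsilon>)"
      using C(2)[of t s] ts \<epsilon>(2) by (simp add: algebra_simps abs_le_iff)
    also have "\<dots> < 0"
      using \<epsilon>(1,3) ts(2) by (intro mult_pos_neg) (auto simp: algebra_simps)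
    finally show "energy (\<lambda>x. t *\<^sub>R Z x + s *\<^sub>R Y x) < energy (\<lambda>x. t *\<^sub>R Z x)"
      by simp
  qed
qed

end

lemma DERIV_interior_max:
  fixes f :: "real \<Rightarrow> real"
  assumes deriv: "\<And>t. (f has_real_derivative f' t) (at t)"
    and c_mem: "c \<in> {a..b}" and ends: "f a < f c" "f b < f c"
  obtains t where "a < t" "t < b" "f' t = 0" "f c \<le> f t"
proof -
  have "continuous_on {a..b} f"
    by (intro continuous_at_imp_continuous_on ballI DERIV_isCont[OF deriv])
  then obtain t where t: "t \<in> {a..b}" "\<And>r. r \<in> {a..b} \<Longrightarrow> f r \<le> f t"
    using continuous_attains_sup[of "{a..b}" f] c_mem by auto
  then have "f c \<le> f t"
    using c_mem by blast
  then have inside: "a < t" "t < b"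
    using t(1) ends by (auto simp: less_le)
  have "f' t = 0"
    using inside t(2)
    by (intro DERIV_local_max[OF deriv, of "min (t - a) (b - t)"])
      (auto simp: abs_if split: if_splits)
  then show thesis
    using that inside \<open>f c \<le> f t\<close> by blast
qed

text \<open>To be read with \<open>g t s = J (t (z + s y))\<close>.\<close>

lemma fibre_maximum_below:
  fixes g g' :: "real \<Rightarrow> real \<Rightarrow> real"
  assumes \<epsilon>: "0 < \<epsilon>" "\<epsilon> < 1"
    and deriv: "\<And>t s. ((\<lambda>t. g t s) has_real_derivative g' t s) (at t)"
    and cont: "\<And>t. ((\<lambda>s. g t s) \<longlongrightarrow> g t 0) (at_right 0)"
    and ray: "\<And>t. 0 < t \<Longrightarrow> t \<noteq> 1 \<Longrightarrow> g t 0 < g 1 0"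
    and descent: "\<And>t s. \<bar>t - 1\<bar> \<le> \<epsilon> \<Longrightarrow> 0 < s \<Longrightarrow> s \<le> \<epsilon> \<Longrightarrow> g t s < g t 0"
  obtains t s r where "0 < t" "g' t s = 0" "g t s < g 1 0" "g r s < g t s"
proof -
  have below: "\<forall>\<^sub>F s in at_right 0. g t s < g 1 s" if "0 < t" "t \<noteq> 1" for t
  proof -
    have "\<forall>\<^sub>F s in at_right 0. g t s - g 1 s < 0"
      using tendsto_diff[OF cont cont] by (rule order_tendstoD(2)) (use ray that in simp)
    then show ?thesis
      by eventually_elim simp
  qed
  have "\<forall>\<^sub>F s in at_right 0. 0 < s \<and> s \<le> \<epsilon>"
    unfolding eventually_at_right_field using \<epsilon>(1) by (intro exI[of _ \<epsilon>]) auto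
  moreover have "\<forall>\<^sub>F s in at_right 0. g (1 - \<epsilon>) s < g 1 s"
      "\<forall>\<^sub>F s in at_right 0. g (1 + \<epsilon>) s < g 1 s"
    using \<epsilon> by (auto intro!: below)
  ultimately have "\<forall>\<^sub>F s in at_right 0. 0 < s \<and> s \<le> \<epsilon> \<and> g (1 - \<epsilon>) s < g 1 s \<and> g (1 + \<epsilon>) s < g 1 s"
    by eventually_elim blast
  then obtain s where s: "0 < s" "s \<le> \<epsilon>" "g (1 - \<epsilon>) s < g 1 s" "g (1 + \<epsilon>) s < g 1 s"
    using eventually_happens'[OF trivial_limit_at_right_real] by blast
  obtain t where t: "1 - \<epsilon> < t" "t < 1 + \<epsilon>" "g' t s = 0" "g 1 s \<le> g t s"
    using DERIV_interior_max[OF deriv _ s(3,4)] \<epsilon>(1) by auto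
  have "g t s < g t 0"
    using t s by (intro descent) auto
  also have "g t 0 \<le> g 1 0"
    using ray[of t] t \<epsilon> by (cases "t = 1") auto
  finally show thesis
    using that[of t s "1 - \<epsilon>"] t s \<epsilon> by simp
qed

context energy_functional
begin

lemma critical_fibre_point_below:
  assumes Z: "Z \<in> energy_space M" and Y: "Y \<in> energy_space M" and neg: "energy_deriv Z Y < 0"
    and ray: "\<And>t. 0 < t \<Longrightarrow> t \<noteq> 1 \<Longrightarrow> energy (\<lambda>x. t *\<^sub>R Z x) < energy Z"
  obtains t s r W where "W = (\<lambda>x. Z x + s *\<^sub>R Y x)" "0 < t"
    "energy_deriv (\<lambda>x. t *\<^sub>R W x) W = 0" "energy (\<lambda>x. t *\<^sub>R W x) < energy Z"
    "energy (\<lambda>x. r *\<^sub>R W x) < energy (\<lambda>x. t *\<^sub>R W x)"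
proof -
  obtain \<epsilon> where \<epsilon>: "0 < \<epsilon>" "\<And>t s. \<bar>t - 1\<bar> \<le> \<epsilon> \<Longrightarrow> 0 < s \<Longrightarrow> s \<le> \<epsilon> \<Longrightarrow>
      energy (\<lambda>x. t *\<^sub>R Z x + s *\<^sub>R Y x) < energy (\<lambda>x. t *\<^sub>R Z x)"
    by (rule energy_descent[OF Z Y neg]) blast
  define W where "W s x = Z x + s *\<^sub>R Y x" for s x
  define g where "g t s = energy (\<lambda>x. t *\<^sub>R W s x)" for t s
  have tW: "t *\<^sub>R W s x = t *\<^sub>R Z x + (t * s) *\<^sub>R Y x" for t s x
    by (simp add: W_def scaleR_add_right)
  obtain t s r where "0 < t" "energy_deriv (\<lambda>x. t *\<^sub>R W s x) (W s) = 0"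
    "g t s < g 1 0" "g r s < g t s"
  proof (rule fibre_maximum_below)
    show "0 < min (1/2) (\<epsilon> / 2)" "min (1/2) (\<epsilon> / 2) < 1"
      using \<epsilon>(1) by auto
    show "((\<lambda>t. g t s) has_real_derivative energy_deriv (\<lambda>x. t *\<^sub>R W s x) (W s)) (at t)" for t s
      using energy_space_lincomb[OF Z Y, of 1 s] unfolding g_def
      by (intro DERIV_energy_ray) (simp add: W_def[abs_def])
    show "((\<lambda>s. g t s) \<longlongrightarrow> g t 0) (at_right 0)" for t
    proof -
      have "isCont (\<lambda>s. energy (\<lambda>x. t *\<^sub>R Z x + s *\<^sub>R t *\<^sub>R Y x)) 0"
        by (rule DERIV_isCont[OF DERIV_energy_line]) (intro energy_space_scaleR Z Y)+
      then show ?thesis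
        by (simp add: isCont_def filterlim_at_split g_def tW mult.commute)
    qed
    show "g t 0 < g 1 0" if "0 < t" "t \<noteq> 1" for t
      using ray[OF that] by (simp add: g_def W_def)
    show "g t s < g t 0"
      if ts: "\<bar>t - 1\<bar> \<le> min (1/2) (\<epsilon> / 2)" "0 < s" "s \<le> min (1/2) (\<epsilon> / 2)" for t s
    proof -
      have "0 < t" "t \<le> 2" "\<bar>t - 1\<bar> \<le> \<epsilon>" "s \<le> \<epsilon> / 2"
        using ts by (auto simp: abs_if split: if_splits)
      then show ?thesis
        using \<epsilon>(2)[of t "t * s"] ts(2) mult_mono[of t 2 s "\<epsilon> / 2"] by (simp add: g_def tW)
    qed
  qed
  then show thesis
    by (intro that[of "W s" s t r]) (simp_all add: g_def W_def[abs_def])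
qed

lemma Nehari_descent:
  assumes Z: "Z \<in> energy_space M" and Y: "Y \<in> energy_space M" and neg: "energy_deriv Z Y < 0"
    and ray: "\<And>t. 0 < t \<Longrightarrow> t \<noteq> 1 \<Longrightarrow> energy (\<lambda>x. t *\<^sub>R Z x) < energy Z"
  obtains \<alpha> \<beta> W where "W = (\<lambda>x. \<alpha> *\<^sub>R Z x + \<beta> *\<^sub>R Y x)" "energy_deriv W W = 0"
    "\<not> (AE x in M. W x = 0)" "energy W < energy Z"
proof -
  obtain t s r W where W: "W = (\<lambda>x. Z x + s *\<^sub>R Y x)" and t: "0 < t"
    and critical: "energy_deriv (\<lambda>x. t *\<^sub>R W x) W = 0"
    and below: "energy (\<lambda>x. t *\<^sub>R W x) < energy Z"
    and nonconstant: "energy (\<lambda>x. r *\<^sub>R W x) < energy (\<lambda>x. t *\<^sub>R W x)"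
    by (rule critical_fibre_point_below[OF Z Y neg ray])
  have W_space: "W \<in> energy_space M"
    using energy_space_lincomb[OF Z Y, of 1 s] by (simp add: W)
  have "\<not> (AE x in M. t *\<^sub>R W x = 0)"
  proof
    assume "AE x in M. t *\<^sub>R W x = 0"
    then have "AE x in M. r *\<^sub>R W x = t *\<^sub>R W x"
      by eventually_elim (use t in simp)
    then have "energy (\<lambda>x. r *\<^sub>R W x) = energy (\<lambda>x. t *\<^sub>R W x)"
      by (intro energy_cong_AE energy_space_scaleR W_space)
    with nonconstant show False
      by simp
  qed
  moreover have "energy_deriv (\<lambda>x. t *\<^sub>R W x) (\<lambda>x. t *\<^sub>R W x) = 0"
    by (simp add: energy_deriv_scaleR critical)
  ultimately show thesis
    using below by (intro that[of "\<lambda>x. t *\<^sub>R W x" t "t * s"]) (simp_all add: W scaleR_add_right)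
qed

theorem Nehari_minimiser_critical:
  assumes Z: "Z \<in> energy_space M" and Y: "Y \<in> energy_space M"
    and ray: "\<And>t. 0 < t \<Longrightarrow> t \<noteq> 1 \<Longrightarrow> energy (\<lambda>x. t *\<^sub>R Z x) < energy Z"
    and minimal: "\<And>\<alpha> \<beta> W. W = (\<lambda>x. \<alpha> *\<^sub>R Z x + \<beta> *\<^sub>R Y x) \<Longrightarrow> energy_deriv W W = 0 \<Longrightarrow>
      \<not> (AE x in M. W x = 0) \<Longrightarrow> energy Z \<le> energy W"
  shows "energy_deriv Z Y = 0"
proof -
  have "0 \<le> energy_deriv Z (\<lambda>x. r *\<^sub>R Y x)" for r
  proof (rule ccontr)
    assume "\<not> 0 \<le> energy_deriv Z (\<lambda>x. r *\<^sub>R Y x)"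
    then have neg: "energy_deriv Z (\<lambda>x. r *\<^sub>R Y x) < 0"
      by simp
    obtain \<alpha> \<beta> W where "W = (\<lambda>x. \<alpha> *\<^sub>R Z x + \<beta> *\<^sub>R r *\<^sub>R Y x)" "energy_deriv W W = 0"
      "\<not> (AE x in M. W x = 0)" "energy W < energy Z"
      by (rule Nehari_descent[OF Z energy_space_scaleR[OF Y] neg ray])
    then show False
      using minimal[of W \<alpha> "\<beta> * r"] by simp
  qed
  from this[of 1] this[of "- 1"] show ?thesis
    unfolding energy_deriv_scaleR by simp
qed

end

section \<open>Superquadratic energies\<close>

lemma energy_functional_diff:
  assumes "energy_functional j dj" "energy_functional k dk"
  shows "energy_functional (\<lambda>z. j z - k z) (\<lambda>z y. dj z y - dk z y)"
proof
  interpret j: energy_functional _ j dj by fact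
  interpret k: energy_functional _ k dk by fact
  show "((\<lambda>z. j z - k z) has_derivative (\<lambda>y. dj z y - dk z y)) (at z)" for z
    by (intro has_derivative_diff j.j_has_derivative k.j_has_derivative)
  show "j 0 - k 0 = 0" "dj 0 y - dk 0 y = 0" for y
    by (simp_all add: j.j_0 k.j_0 j.dj_0 k.dj_0)
  fix R
  obtain C where C: "C \<ge> 0" "\<And>z z' y. norm (fst z) \<le> R \<Longrightarrow> norm (fst z') \<le> R \<Longrightarrow>
      \<bar>dj z y - dj z' y\<bar> \<le> C * norm (z - z') * norm y"
    using j.dj_Lipschitz by blast
  obtain D where D: "D \<ge> 0" "\<And>z z' y. norm (fst z) \<le> R \<Longrightarrow> norm (fst z') \<le> R \<Longrightarrow>
      \<bar>dk z y - dk z' y\<bar> \<le> D * norm (z - z') * norm y"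
    using k.dj_Lipschitz by blast
  have "\<bar>(dj z y - dk z y) - (dj z' y - dk z' y)\<bar> \<le> (C + D) * norm (z - z') * norm y"
    if "norm (fst z) \<le> R" "norm (fst z') \<le> R" for z z' y
    using C(2)[OF that, of y] D(2)[OF that, of y] by (simp add: distrib_right)
  then show "\<exists>C\<ge>0. \<forall>z z' y. norm (fst z) \<le> R \<longrightarrow> norm (fst z') \<le> R \<longrightarrow>
      \<bar>(dj z y - dk z y) - (dj z' y - dk z' y)\<bar> \<le> C * norm (z - z') * norm y"
    using C(1) D(1) by (intro exI[of _ "C + D"]) auto
qed

lemma powr_diff_quotient_strict_mono:
  fixes t q r :: real
  assumes "0 < t" "t \<noteq> 1" "0 < q" "q < r"
  shows "(t powr q - 1) / q < (t powr r - 1) / r"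
proof -
  define f where "f s = (s powr r - 1) / r - (s powr q - 1) / q" for s
  have deriv: "(f has_real_derivative s powr (r - 1) - s powr (q - 1)) (at s)" if "0 < s" for s
    unfolding f_def using that assms by (auto intro!: derivative_eq_intros)
  have "f 1 < f t"
  proof (cases "1 < t")
    case True
    then show ?thesis
    proof (rule DERIV_pos_imp_increasing_open)
      show "\<exists>y. (f has_real_derivative y) (at s) \<and> 0 < y" if "1 < s" for s
        using deriv[of s] that assms(4) by (intro exI conjI) (auto intro: powr_less_mono)
      show "continuous_on {1..t} f"
        by (intro continuous_at_imp_continuous_on ballI DERIV_isCont[OF deriv]) auto
    qed
  next
    case False
    with assms(2) have "t < 1"
      by simp
    then show ?thesis
    proof (rule DERIV_neg_imp_decreasing_open)
      show "\<exists>y. (f has_real_derivative y) (at s) \<and> y < 0" if "t < s" "s < 1" for s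
        using deriv[of s] that assms(1,4) by (intro exI conjI) (auto intro!: powr_less_mono')
      show "continuous_on {t..1} f"
        using assms(1) by (intro continuous_at_imp_continuous_on ballI DERIV_isCont[OF deriv]) auto
    qed
  qed
  then show ?thesis
    by (simp add: f_def)
qed

lemma power_growth:
  fixes f f' :: "real \<Rightarrow> real"
  assumes deriv: "\<And>s. (f has_real_derivative f' s) (at s)" and q: "0 < q"
    and deriv_ge: "\<And>s. 1 \<le> s \<Longrightarrow> s powr q * f' 1 \<le> s * f' s"
    and deriv_le: "\<And>s. 0 < s \<Longrightarrow> s \<le> 1 \<Longrightarrow> s * f' s \<le> s powr q * f' 1" and t: "0 \<le> t"
  shows "f' 1 * ((t powr q - 1) / q) \<le> f t - f 1"
proof -
  define d where "d s = f s - f' 1 * (s powr q / q)" for s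
  have d_deriv: "(d has_real_derivative (s * f' s - s powr q * f' 1) / s) (at s)" if "0 < s" for s
  proof -
    have "(d has_real_derivative f' s - f' 1 * s powr (q - 1)) (at s)"
      unfolding d_def using that q by (auto intro!: derivative_eq_intros deriv)
    moreover have "s powr q = s powr (q - 1) * s"
      using powr_add[of s "q - 1" 1] that by simp
    ultimately show ?thesis
      using that by (simp add: diff_divide_distrib mult_ac)
  qed
  have cont: "continuous_on {0..} d"
    unfolding d_def using q
    by (intro continuous_on_diff continuous_on_mult continuous_on_divide
        continuous_on_powr' continuous_intros
        continuous_at_imp_continuous_on[of _ f] ballI DERIV_isCont[OF deriv]) auto
  have "d 1 \<le> d t"
  proof (cases "1 \<le> t")
    case True
    then show ?thesis
    proof (rule DERIV_nonneg_imp_increasing_open)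
      show "\<exists>y. (d has_real_derivative y) (at s) \<and> 0 \<le> y" if "1 < s" for s
        using d_deriv[of s] deriv_ge[of s] that by (intro exI conjI) auto
    qed (intro continuous_on_subset[OF cont], auto)
  next
    case False
    then have "t \<le> 1"
      by simp
    then show ?thesis
    proof (rule DERIV_nonpos_imp_decreasing_open)
      show "\<exists>y. (d has_real_derivative y) (at s) \<and> y \<le> 0" if "t < s" "s < 1" for s
        using d_deriv[of s] deriv_le[of s] that t by (intro exI conjI)
          (auto intro: divide_nonpos_pos)
    qed (intro continuous_on_subset[OF cont], use t in auto)
  qed
  then show ?thesis
    by (simp add: d_def diff_divide_distrib right_diff_distrib)
qed

locale superquadratic_energy =
  fixes M :: "'m measure"
    and B :: "'a::euclidean_space \<times> 'b::euclidean_space \<Rightarrow> 'a \<times> 'b \<Rightarrow> real"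
    and F :: "'a \<Rightarrow> real" and DF :: "'a \<Rightarrow> 'a" and p :: real
  assumes B_bilinear: "bounded_bilinear B"
    and B_sym: "B y z = B z y"
    and B_pos: "z \<noteq> 0 \<Longrightarrow> 0 < B z z"
    and F_0: "F 0 = 0"
    and F_deriv: "(F has_derivative (\<lambda>h. DF w \<bullet> h)) (at w)"
    and DF_Lipschitz: "\<exists>C. C-lipschitz_on (cball 0 R) DF"
    and p_pos: "p > 0"
    and DF_scaling: "t \<ge> 1 \<Longrightarrow> t powr (p + 2) * (DF w \<bullet> w) \<le> DF (t *\<^sub>R w) \<bullet> (t *\<^sub>R w)"
begin

interpretation B: bounded_bilinear B
  by (rule B_bilinear)

lemma DF_scaling_le_one:
  assumes "0 < t" "t \<le> 1"
  shows "DF (t *\<^sub>R w) \<bullet> (t *\<^sub>R w) \<le> t powr (p + 2) * (DF w \<bullet> w)"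
proof -
  have "(1/t) powr (p + 2) * (DF (t *\<^sub>R w) \<bullet> (t *\<^sub>R w)) \<le> DF w \<bullet> w"
    using DF_scaling[of "1/t" "t *\<^sub>R w"] assms by simp
  with assms show ?thesis
    by (simp add: powr_divide field_simps)
qed

text \<open>Superquadratic growth of \<open>DF w \<bullet> w\<close> along rays excludes a linear part of \<open>F\<close> at the origin.\<close>

lemma DF_0: "DF 0 = 0"
proof -
  obtain C where C: "C-lipschitz_on (cball 0 1) DF"
    using DF_Lipschitz by blast
  then have cont: "isCont DF 0"
    using lipschitz_on_continuous_on[of C "ball 0 1" DF]
      lipschitz_on_subset[of C "cball 0 1" DF "ball 0 1"]
    by (auto simp: continuous_on_eq_continuous_at)
  let ?w = "DF 0"
  have "DF (t *\<^sub>R ?w) \<bullet> ?w \<le> t powr (p + 1) * (DF ?w \<bullet> ?w)" if t: "0 < t" "t \<le> 1" for t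
  proof -
    have "t powr (p + 2) = t * t powr (p + 1)"
      using powr_add[of t 1 "p + 1"] t by (simp add: add.commute)
    then have "t * (DF (t *\<^sub>R ?w) \<bullet> ?w) \<le> t * (t powr (p + 1) * (DF ?w \<bullet> ?w))"
      using DF_scaling_le_one[OF t, of ?w] by (simp add: mult.assoc)
    with t show ?thesis
      by simp
  qed
  then have "\<forall>\<^sub>F t in at_right 0. DF (t *\<^sub>R ?w) \<bullet> ?w \<le> t powr (p + 1) * (DF ?w \<bullet> ?w)"
    unfolding eventually_at_right_field by (intro exI[of _ 1]) auto
  moreover have "((\<lambda>t. DF (t *\<^sub>R ?w) \<bullet> ?w) \<longlongrightarrow> ?w \<bullet> ?w) (at_right 0)"
    by (intro tendsto_inner isCont_tendsto_compose[OF cont] tendsto_const)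
      (auto intro!: tendsto_eq_intros)
  moreover have "((\<lambda>t. t powr (p + 1) * (DF ?w \<bullet> ?w)) \<longlongrightarrow> 0 powr (p + 1) * (DF ?w \<bullet> ?w)) (at_right 0)"
    using p_pos by (intro tendsto_mult tendsto_const tendsto_powr' tendsto_ident_at)
      (auto simp: eventually_at_right_field intro!: exI[of _ 1])
  ultimately have "?w \<bullet> ?w \<le> 0 powr (p + 1) * (DF ?w \<bullet> ?w)"
    using tendsto_le[OF trivial_limit_at_right_real] by blast
  then show ?thesis
    using inner_ge_zero[of ?w] by (simp del: inner_ge_zero)
qed

sublocale quadratic: energy_functional M "\<lambda>z. B z z / 2" B
proof
  show "((\<lambda>z. B z z / 2) has_derivative B z) (at z)" for z
    using bounded_linear.has_derivative[OF bounded_linear_divide[of 2]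
      B.FDERIV[OF has_derivative_ident has_derivative_ident]]
    by (rule has_derivative_eq_rhs) (auto simp: B_sym)
  obtain K where K: "K \<ge> 0" "\<And>z y. norm (B z y) \<le> norm z * norm y * K"
    using B.nonneg_bounded by blast
  then have "\<bar>B z y - B z' y\<bar> \<le> K * norm (z - z') * norm y" for z z' y
    using K(2)[of "z - z'" y] by (simp add: B.diff_left mult_ac)
  with K(1) show "\<exists>C\<ge>0. \<forall>z z' y. norm (fst z) \<le> R \<longrightarrow> norm (fst z') \<le> R \<longrightarrow>
      \<bar>B z y - B z' y\<bar> \<le> C * norm (z - z') * norm y" for R
    by blast
qed (simp_all add: B.zero_left)

sublocale potential: energy_functional M "\<lambda>z :: 'a \<times> 'b. F (fst z)" "\<lambda>z y. DF (fst z) \<bullet> fst y"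
proof
  show "((\<lambda>z :: 'a \<times> 'b. F (fst z)) has_derivative (\<lambda>y. DF (fst z) \<bullet> fst y)) (at z)" for z
    by (rule has_derivative_compose[OF has_derivative_fst[OF has_derivative_ident] F_deriv])
  fix R
  obtain C where C: "C-lipschitz_on (cball 0 R) DF"
    using DF_Lipschitz by blast
  have "\<bar>DF (fst z) \<bullet> fst y - DF (fst z') \<bullet> fst y\<bar> \<le> C * norm (z - z') * norm y"
    if "norm (fst z) \<le> R" "norm (fst z') \<le> R" for z z' y :: "'a \<times> 'b"
  proof -
    have "\<bar>DF (fst z) \<bullet> fst y - DF (fst z') \<bullet> fst y\<bar>
        \<le> norm (DF (fst z) - DF (fst z')) * norm (fst y)"
      using Cauchy_Schwarz_ineq2[of "DF (fst z) - DF (fst z')" "fst y"]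
      by (simp add: inner_diff_left)
    also have "\<dots> \<le> C * norm (fst (z - z')) * norm (fst y)"
      using lipschitz_on_normD[OF C, of "fst z" "fst z'"] that by (intro mult_right_mono) auto
    also have "\<dots> \<le> C * norm (z - z') * norm y"
      using lipschitz_on_nonneg[OF C] norm_fst_le[of "fst u" "snd u" for u :: "'a \<times> 'b"]
      by (intro mult_mono mult_left_mono mult_nonneg_nonneg)
        (simp_all only: prod.collapse norm_ge_zero)
    finally show ?thesis .
  qed
  with lipschitz_on_nonneg[OF C]
  show "\<exists>C\<ge>0. \<forall>(z :: 'a \<times> 'b) z' (y :: 'a \<times> 'b). norm (fst z) \<le> R \<longrightarrow> norm (fst z') \<le> R \<longrightarrow>
      \<bar>DF (fst z) \<bullet> fst y - DF (fst z') \<bullet> fst y\<bar> \<le> C * norm (z - z') * norm y"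
    by blast
qed (simp_all add: F_0 DF_0)

sublocale energy_functional M "\<lambda>z. B z z / 2 - F (fst z)" "\<lambda>z y. B z y - DF (fst z) \<bullet> fst y"
  by (rule energy_functional_diff[OF quadratic.energy_functional_axioms
        potential.energy_functional_axioms])

lemma energy_split:
  assumes "Z \<in> energy_space M"
  shows "energy Z = quadratic.energy Z - potential.energy Z"
  unfolding energy_def quadratic.energy_def potential.energy_def
  using quadratic.integrable_energy[OF assms] potential.integrable_energy[OF assms] by simp

lemma energy_deriv_split:
  assumes "Z \<in> energy_space M" "Y \<in> energy_space M"
  shows "energy_deriv Z Y = quadratic.energy_deriv Z Y - potential.energy_deriv Z Y"
  unfolding energy_deriv_def quadratic.energy_deriv_def potential.energy_deriv_def
  using quadratic.integrable_energy_deriv[OF assms] potential.integrable_energy_deriv[OF assms]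
  by simp

lemma quadratic_energy_eq: "quadratic.energy Z = quadratic.energy_deriv Z Z / 2"
  by (simp add: quadratic.energy_def quadratic.energy_deriv_def)

lemma quadratic_energy_scaleR: "quadratic.energy (\<lambda>x. t *\<^sub>R Z x) = t\<^sup>2 * quadratic.energy Z"
  by (simp add: quadratic.energy_def B.scaleR_left B.scaleR_right power2_eq_square mult.assoc)

lemma B_nonneg: "0 \<le> B z z" and B_eq_0_iff: "B z z = 0 \<longleftrightarrow> z = 0"
  using B_pos[of z] by (cases "z = 0"; simp add: B.zero_left)+

lemma F_growth_along_ray:
  assumes t: "t \<ge> 0"
  shows "(DF w \<bullet> w) * ((t powr (p + 2) - 1) / (p + 2)) \<le> F (t *\<^sub>R w) - F w"
proof -
  have F_line: "((\<lambda>s. F (s *\<^sub>R w)) has_real_derivative DF (s *\<^sub>R w) \<bullet> w) (at s)" for s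
    unfolding has_field_derivative_def
    by (rule has_derivative_eq_rhs[OF has_derivative_compose[OF _ F_deriv]])
      (auto intro!: derivative_eq_intros simp: fun_eq_iff)
  have "(DF (1 *\<^sub>R w) \<bullet> w) * ((t powr (p + 2) - 1) / (p + 2)) \<le> F (t *\<^sub>R w) - F (1 *\<^sub>R w)"
  proof (rule power_growth[OF F_line])
    show "s powr (p + 2) * (DF (1 *\<^sub>R w) \<bullet> w) \<le> s * (DF (s *\<^sub>R w) \<bullet> w)" if "1 \<le> s" for s
      using DF_scaling[OF that, of w] by simp
    show "s * (DF (s *\<^sub>R w) \<bullet> w) \<le> s powr (p + 2) * (DF (1 *\<^sub>R w) \<bullet> w)" if "0 < s" "s \<le> 1" for s
      using DF_scaling_le_one[OF that, of w] by simp
  qed (use p_pos t in auto)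
  then show ?thesis
    by simp
qed

lemma potential_growth_along_ray:
  assumes Z: "Z \<in> energy_space M" and "t \<ge> 0"
  shows "potential.energy_deriv Z Z * ((t powr (p + 2) - 1) / (p + 2))
    \<le> potential.energy (\<lambda>x. t *\<^sub>R Z x) - potential.energy Z"
proof -
  note int = potential.integrable_energy[OF Z]
    potential.integrable_energy[OF energy_space_scaleR[OF Z], of t]
    potential.integrable_energy_deriv[OF Z Z]
  have "(LINT x|M. (DF (fst (Z x)) \<bullet> fst (Z x)) * ((t powr (p + 2) - 1) / (p + 2)))
      \<le> (LINT x|M. F (fst (t *\<^sub>R Z x)) - F (fst (Z x)))"
    using int F_growth_along_ray[OF assms(2)] by (intro integral_mono) auto
  then show ?thesis
    unfolding potential.energy_def potential.energy_deriv_def using int by simp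
qed

lemma energy_nonneg_on_Nehari:
  assumes Z: "Z \<in> energy_space M" and Nehari: "energy_deriv Z Z = 0"
  shows "0 \<le> energy Z"
proof -
  let ?I = "quadratic.energy_deriv Z Z"
  have derivs_eq: "potential.energy_deriv Z Z = ?I"
    using energy_deriv_split[OF Z Z] Nehari by simp
  have I_nonneg: "0 \<le> ?I"
    by (simp add: quadratic.energy_deriv_def B_nonneg integral_nonneg_AE)
  have "potential.energy Z \<le> ?I / (p + 2)"
    using potential_growth_along_ray[OF Z order_refl] p_pos
    by (simp add: derivs_eq potential.energy_def F_0)
  also have "\<dots> \<le> ?I / 2"
    using I_nonneg p_pos by (intro divide_left_mono) auto
  finally show ?thesis
    by (simp add: energy_split[OF Z] quadratic_energy_eq)
qed

lemma energy_less_along_ray: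
  assumes Z: "Z \<in> energy_space M" and Nehari: "energy_deriv Z Z = 0"
    and nz: "0 < quadratic.energy_deriv Z Z" and t: "0 < t" "t \<noteq> 1"
  shows "energy (\<lambda>x. t *\<^sub>R Z x) < energy Z"
proof -
  let ?I = "quadratic.energy_deriv Z Z"
  have "potential.energy_deriv Z Z = ?I"
    using energy_deriv_split[OF Z Z] Nehari by simp
  then have "?I * ((t powr (p + 2) - 1) / (p + 2))
      \<le> potential.energy (\<lambda>x. t *\<^sub>R Z x) - potential.energy Z"
    using potential_growth_along_ray[OF Z, of t] t by simp
  moreover have "?I * ((t powr 2 - 1) / 2) < ?I * ((t powr (p + 2) - 1) / (p + 2))"
    using nz t p_pos by (intro mult_strict_left_mono powr_diff_quotient_strict_mono) auto
  moreover have "quadratic.energy (\<lambda>x. t *\<^sub>R Z x) - quadratic.energy Z = ?I * ((t powr 2 - 1) / 2)"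
    using t(1) by (simp add: quadratic_energy_scaleR quadratic_energy_eq[of Z] algebra_simps)
  ultimately show ?thesis
    unfolding energy_split[OF Z] energy_split[OF energy_space_scaleR[OF Z]] by linarith
qed

theorem ground_state_critical:
  assumes Z: "Z \<in> energy_space M" and Y: "Y \<in> energy_space M" and Nehari: "energy_deriv Z Z = 0"
    and minimal: "\<And>\<alpha> \<beta> W. W = (\<lambda>x. \<alpha> *\<^sub>R Z x + \<beta> *\<^sub>R Y x) \<Longrightarrow> energy_deriv W W = 0 \<Longrightarrow>
      \<not> (AE x in M. W x = 0) \<Longrightarrow> energy Z \<le> energy W"
  shows "energy_deriv Z Y = 0"
proof (cases "AE x in M. Z x = 0")
  case True
  then have "AE x in M. B (Z x) (Y x) - DF (fst (Z x)) \<bullet> fst (Y x) = 0"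
    by eventually_elim (simp add: B.zero_left DF_0)
  then show ?thesis
    unfolding energy_deriv_def by (rule integral_eq_zero_AE)
next
  case False
  have nz: "0 < quadratic.energy_deriv Z Z"
  proof (rule ccontr)
    assume "\<not> 0 < quadratic.energy_deriv Z Z"
    moreover have "0 \<le> quadratic.energy_deriv Z Z"
      by (simp add: quadratic.energy_deriv_def B_nonneg integral_nonneg_AE)
    ultimately have "(LINT x|M. B (Z x) (Z x)) = 0"
      by (simp add: quadratic.energy_deriv_def)
    then have "AE x in M. B (Z x) (Z x) = 0"
      using integral_nonneg_eq_0_iff_AE[OF quadratic.integrable_energy_deriv[OF Z Z]]
        B_nonneg
      by simp
    then have "AE x in M. Z x = 0"
      by (simp add: B_eq_0_iff)
    with False show False ..
  qed
  show ?thesis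
  proof (rule Nehari_minimiser_critical[OF Z Y])
    show "energy (\<lambda>x. t *\<^sub>R Z x) < energy Z" if "0 < t" "t \<noteq> 1" for t
      using Z Nehari nz that by (rule energy_less_along_ray)
  qed (rule minimal)
qed

end

section \<open>Jets of Sobolev functions\<close>

lemma vec4_nth [simp]:
  "vec4 x1 x2 x3 x4 $ 1 = x1" "vec4 x1 x2 x3 x4 $ 2 = x2"
  "vec4 x1 x2 x3 x4 $ 3 = x3" "vec4 x1 x2 x3 x4 $ 4 = x4"
  by (simp_all add: vec4_def vector_def)

lemma vec4_eq: "vec4 x1 x2 x3 x4 =
  x1 *\<^sub>R axis 1 1 + x2 *\<^sub>R axis 2 1 + x3 *\<^sub>R axis 3 1 + x4 *\<^sub>R axis 4 1"
  by (simp add: vec_eq_iff forall_4 axis_def)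

lemma norm_vec4_sq: "(norm (vec4 x1 x2 x3 x4))\<^sup>2 = x1\<^sup>2 + x2\<^sup>2 + x3\<^sup>2 + x4\<^sup>2"
  by (simp add: norm_vec_def L2_set_def sum_4)

definition jet :: "(real \<Rightarrow> real) \<Rightarrow> (real \<Rightarrow> real) \<Rightarrow> real \<Rightarrow> (real^4) \<times> real \<times> real" where
  "jet \<psi> v x = (vec4 (\<psi> x) (wd \<psi> x) (v x) (wd v x), wd (wd \<psi>) x, wd (wd v) x)"

lemma norm_jet_sq:
  "(norm (jet \<psi> v x))\<^sup>2 = ((\<psi> x)\<^sup>2 + (wd \<psi> x)\<^sup>2 + (wd (wd \<psi>) x)\<^sup>2)
    + ((v x)\<^sup>2 + (wd v x)\<^sup>2 + (wd (wd v) x)\<^sup>2)"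
  by (simp add: jet_def norm_Pair norm_vec4_sq)

lemma H2_norm_sq_nonneg: "0 \<le> H2_norm_sq u"
  unfolding H2_norm_sq_def by (intro integral_nonneg_AE) auto

lemma X_norm_nonneg: "0 \<le> X_norm \<psi> v"
  by (simp add: X_norm_def H2_norm_sq_nonneg)

lemma X_norm_sq: "(X_norm \<psi> v)\<^sup>2 = H2_norm_sq \<psi> + H2_norm_sq v"
  by (simp add: X_norm_def H2_norm_sq_nonneg)

lemma integrable_H2_norm_sq:
  assumes "H2 u"
  shows "integrable lborel (\<lambda>x. (u x)\<^sup>2 + (wd u x)\<^sup>2 + (wd (wd u) x)\<^sup>2)"
  using H2D(1-3)[OF assms] unfolding sq_int_def by auto

lemma integral_norm_jet_sq:
  assumes "H2 \<psi>" "H2 v"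
  shows "integrable lborel (\<lambda>x. (norm (jet \<psi> v x))\<^sup>2)"
    "(LINT x|lborel. (norm (jet \<psi> v x))\<^sup>2) = (X_norm \<psi> v)\<^sup>2"
  unfolding norm_jet_sq X_norm_sq H2_norm_sq_def
  by (intro Bochner_Integration.integrable_add Bochner_Integration.integral_add
      integrable_H2_norm_sq assms)+

lemma H2_AE_bounded:
  assumes "H2 u"
  shows "AE x in lborel. (u x)\<^sup>2 + (wd u x)\<^sup>2 \<le> 4 * H2_norm_sq u"
proof -
  note u = H2D[OF assms]
  define A0 A1 A2 where "A0 = (LINT x|lborel. (u x)\<^sup>2)" and "A1 = (LINT x|lborel. (wd u x)\<^sup>2)"
    and "A2 = (LINT x|lborel. (wd (wd u) x)\<^sup>2)"
  have nonneg: "0 \<le> A0" "0 \<le> A2"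
    by (simp_all add: A0_def A2_def integral_nonneg_AE)
  have norm: "H2_norm_sq u = A0 + A1 + A2"
    using u(1-3) by (simp add: H2_norm_sq_def sq_int_def A0_def A1_def A2_def)
  have "AE x in lborel. (u x)\<^sup>2 \<le> 2 * (A0 + A1)" "AE x in lborel. (wd u x)\<^sup>2 \<le> 2 * (A1 + A2)"
    unfolding A0_def A1_def A2_def by (intro weak_deriv_AE_bounded u)+
  then show ?thesis
    by eventually_elim (use nonneg in \<open>simp add: norm\<close>)
qed

lemma jet_AE_bounded:
  assumes "H2 \<psi>" "H2 v"
  shows "AE x in lborel. norm (fst (jet \<psi> v x)) \<le> 2 * X_norm \<psi> v"
  using H2_AE_bounded[OF assms(1)] H2_AE_bounded[OF assms(2)]
proof eventually_elim
  case (elim x)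
  then have "(norm (fst (jet \<psi> v x)))\<^sup>2 \<le> (2 * X_norm \<psi> v)\<^sup>2"
    by (simp add: jet_def norm_vec4_sq power_mult_distrib X_norm_sq)
  then show ?case
    by (rule power2_le_imp_le) (simp add: X_norm_nonneg)
qed

lemma jet_in_energy_space:
  assumes "H2 \<psi>" "H2 v"
  shows "jet \<psi> v \<in> energy_space lborel"
proof -
  note [measurable] = H2D(1-3)[OF assms(1), unfolded sq_int_def, THEN conjunct1]
    H2D(1-3)[OF assms(2), unfolded sq_int_def, THEN conjunct1]
  have "jet \<psi> v \<in> borel_measurable lborel"
    unfolding jet_def[abs_def] vec4_eq by measurable
  then show ?thesis
    unfolding energy_space_def using integral_norm_jet_sq(1)[OF assms] jet_AE_bounded[OF assms]
    by blast
qed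

lemma jet_lincomb:
  assumes "H2 \<psi>" "H2 v" "H2 h" "H2 k"
  shows "AE x in lborel. jet (\<lambda>x. \<alpha> * \<psi> x + \<beta> * h x) (\<lambda>x. \<alpha> * v x + \<beta> * k x) x
    = \<alpha> *\<^sub>R jet \<psi> v x + \<beta> *\<^sub>R jet h k x"
  using H2_lincomb(2,3)[OF assms(1,3), of \<alpha> \<beta>] H2_lincomb(2,3)[OF assms(2,4), of \<alpha> \<beta>]
  by eventually_elim (simp add: jet_def vec4_eq algebra_simps)

lemma X_zero_imp_jet_zero:
  assumes "H2 \<psi>" "H2 v" "X_zero \<psi> v"
  shows "AE x in lborel. jet \<psi> v x = 0"
proof -
  have wd_zero: "AE x in lborel. wd u x = 0" "AE x in lborel. wd (wd u) x = 0"
    if u: "H2 u" and zero: "AE x in lborel. u x = 0" for u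
  proof -
    have weak_deriv_0: "weak_deriv (\<lambda>_. 0) (\<lambda>_. 0)"
      using weak_deriv_lincomb[OF H2D(4)[OF u] H2D(4)[OF u], of 0 0] by simp
    have "u \<in> borel_measurable borel"
      using H2D(1)[OF u] by (simp add: sq_int_def)
    then have "weak_deriv u (\<lambda>_. 0)"
      using zero by (intro weak_deriv_cong_AE[OF weak_deriv_0]) (auto elim: eventually_mono)
    then show "AE x in lborel. wd u x = 0" "AE x in lborel. wd (wd u) x = 0"
      by (rule wd_weak_deriv(2), rule wd_wd_weak_deriv(2)[OF _ weak_deriv_0])
  qed
  have "AE x in lborel. \<psi> x = 0" "AE x in lborel. v x = 0"
    using assms(3) unfolding X_zero_def by auto
  from this wd_zero[OF assms(1) this(1)] wd_zero[OF assms(2) this(2)] show ?thesis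
    by eventually_elim (simp add: jet_def vec4_eq zero_prod_def)
qed

section \<open>The Boussinesq functional\<close>

lemma has_derivative_grad:
  assumes "f differentiable (at w)"
  shows "(f has_derivative (\<lambda>h. grad f w \<bullet> h)) (at w)"
proof -
  let ?D = "frechet_derivative f (at w)"
  have D: "(f has_derivative ?D) (at w)"
    using assms frechet_derivative_works by blast
  have "?D h = grad f w \<bullet> h" for h
  proof -
    have "?D h = ?D (\<Sum>i\<in>UNIV. h $ i *\<^sub>R axis i 1)"
      using basis_expansion[of h] by (simp add: scalar_mult_eq_scaleR)
    also have "\<dots> = (\<Sum>i\<in>UNIV. h $ i *\<^sub>R ?D (axis i 1))"
      using has_derivative_linear[OF D] by (simp add: linear_sum linear_scale)
    also have "\<dots> = grad f w \<bullet> h"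
      by (simp add: grad_def inner_vec_def mult.commute)
    finally show ?thesis .
  qed
  with D show ?thesis
    by (simp add: has_derivative_eq_rhs fun_eq_iff)
qed

lemma C2_R4_has_derivative:
  assumes "C2_R4 F"
  shows "(F has_derivative (\<lambda>h. grad F w \<bullet> h)) (at w)"
    and "(grad F has_derivative (\<lambda>h. hess F w *v h)) (at w)"
    and "(Gfun F has_derivative (\<lambda>h. grad (Gfun F) w \<bullet> h)) (at w)"
proof -
  show "(F has_derivative (\<lambda>h. grad F w \<bullet> h)) (at w)"
    using assms has_derivative_grad unfolding C2_R4_def by blast
  show deriv_grad: "(grad F has_derivative (\<lambda>h. hess F w *v h)) (at w)"
    using assms jacobian_works unfolding C2_R4_def hess_def by blast
  have "(Gfun F has_derivative (\<lambda>h. w \<bullet> (hess F w *v h) + h \<bullet> grad F w)) (at w)"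
    unfolding Gfun_def[abs_def] by (rule has_derivative_inner[OF has_derivative_ident deriv_grad])
  then show "(Gfun F has_derivative (\<lambda>h. grad (Gfun F) w \<bullet> h)) (at w)"
    by (intro has_derivative_grad differentiableI)
qed

lemma C2_R4_grad_lipschitz:
  assumes "C2_R4 F"
  shows "\<exists>C. C-lipschitz_on (cball 0 R) (grad F)"
proof -
  have "bounded (hess F ` cball 0 R)"
    using assms unfolding C2_R4_def
    by (intro compact_imp_bounded compact_continuous_image) (auto intro: continuous_on_subset)
  then obtain H where H: "H > 0" "\<And>x. x \<in> cball 0 R \<Longrightarrow> norm (hess F x) \<le> H"
    unfolding bounded_pos by force
  have "onorm ((*v) (hess F x)) \<le> real CARD(4) * real CARD(4) * H" if "x \<in> cball 0 R" for x
  proof (rule onorm_le_matrix_component)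
    fix i j
    have "\<bar>hess F x $ i $ j\<bar> \<le> norm (hess F x)"
      by (rule order_trans[OF component_le_norm_cart Finite_Cartesian_Product.norm_nth_le])
    then show "\<bar>hess F x $ i $ j\<bar> \<le> H"
      using H(2)[OF that] by simp
  qed
  then have "(real CARD(4) * real CARD(4) * H)-lipschitz_on (cball 0 R) (grad F)"
    using H(1)
    by (intro bounded_derivative_imp_lipschitz
        [OF has_derivative_at_withinI[OF C2_R4_has_derivative(2)[OF assms]]])
      auto
  then show ?thesis ..
qed

lemma Euler_inequality_scaling:
  fixes G :: "'a::real_normed_vector \<Rightarrow> real"
  assumes deriv: "\<And>w. (G has_derivative DG w) (at w)" and Euler: "\<And>w. q * G w \<le> DG w w"
    and t: "1 \<le> t"
  shows "t powr q * G w \<le> G (t *\<^sub>R w)"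
proof -
  define g where "g s = s powr (- q) * G (s *\<^sub>R w)" for s
  have "g 1 \<le> g t"
  proof (rule DERIV_nonneg_imp_nondecreasing[OF t])
    fix s assume "1 \<le> s" "s \<le> t"
    then have s: "s > 0" by simp
    have "((\<lambda>s. G (s *\<^sub>R w)) has_real_derivative DG (s *\<^sub>R w) w) (at s)"
      unfolding has_field_derivative_def
      by (rule has_derivative_eq_rhs[OF has_derivative_compose[OF _ deriv]])
        (auto intro!: derivative_eq_intros simp: fun_eq_iff
          linear_scale[OF has_derivative_linear[OF deriv]])
    moreover have "((\<lambda>s. s powr (- q)) has_real_derivative - q * s powr (- q - 1)) (at s)"
      using s by (auto intro!: derivative_eq_intros)
    ultimately have "(g has_real_derivative - q * s powr (- q - 1) * G (s *\<^sub>R w)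
        + DG (s *\<^sub>R w) w * s powr (- q)) (at s)"
      unfolding g_def[abs_def] by (intro DERIV_mult)
    moreover have "- q * s powr (- q - 1) * G (s *\<^sub>R w) + DG (s *\<^sub>R w) w * s powr (- q)
        = s powr (- q - 1) * (DG (s *\<^sub>R w) (s *\<^sub>R w) - q * G (s *\<^sub>R w))"
    proof -
      have "s powr (- q) = s powr (- q - 1) * s"
        using powr_add[of s "- q - 1" 1] s by simp
      then show ?thesis
        by (simp add: linear_scale[OF has_derivative_linear[OF deriv]] algebra_simps)
    qed
    ultimately show "\<exists>y. (g has_real_derivative y) (at s) \<and> 0 \<le> y"
      using Euler[of "s *\<^sub>R w"] by (metis diff_ge_0_iff_ge mult_nonneg_nonneg powr_ge_zero)
  qed
  then show ?thesis
    using t by (simp add: g_def powr_minus field_simps)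
qed

definition Boussinesq_form :: "real \<Rightarrow> real \<Rightarrow> real \<Rightarrow> real \<Rightarrow> real \<Rightarrow> real \<Rightarrow> real
    \<Rightarrow> (real^4) \<times> real \<times> real \<Rightarrow> (real^4) \<times> real \<times> real \<Rightarrow> real" where
  "Boussinesq_form a a2 c c2 b b2 \<omega> z y =
     fst z $ 1 * fst y $ 1 - c * (fst z $ 2 * fst y $ 2) + c2 * (fst (snd z) * fst (snd y))
     + fst z $ 3 * fst y $ 3 - a * (fst z $ 4 * fst y $ 4) + a2 * (snd (snd z) * snd (snd y))
     - \<omega> * ((fst z $ 1 * fst y $ 3 + fst z $ 3 * fst y $ 1)
        + b * (fst z $ 2 * fst y $ 4 + fst z $ 4 * fst y $ 2)
        + b2 * (fst (snd z) * snd (snd y) + snd (snd z) * fst (snd y)))"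

lemma bounded_bilinear_Boussinesq_form: "bounded_bilinear (Boussinesq_form a a2 c c2 b b2 \<omega>)"
  unfolding bilinear_conv_bounded_bilinear[symmetric] bilinear_def
  by (auto intro!: linearI simp: Boussinesq_form_def algebra_simps)

lemma Boussinesq_form_sym:
  "Boussinesq_form a a2 c c2 b b2 \<omega> y z = Boussinesq_form a a2 c c2 b b2 \<omega> z y"
  by (simp add: Boussinesq_form_def algebra_simps)

lemma binary_form_pos:
  fixes x y A D m :: real
  assumes "\<bar>m\<bar> < A" "\<bar>m\<bar> < D" "x \<noteq> 0 \<or> y \<noteq> 0"
  shows "0 < A * x\<^sup>2 + D * y\<^sup>2 - 2 * m * (x * y)"
proof -
  have "2 * m * (x * y) \<le> \<bar>m\<bar> * (2 * \<bar>x\<bar> * \<bar>y\<bar>)"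
    using abs_ge_self[of "2 * m * (x * y)"] by (simp add: abs_mult mult_ac)
  also have "\<dots> \<le> \<bar>m\<bar> * (x\<^sup>2 + y\<^sup>2)"
    using sum_squares_bound[of "\<bar>x\<bar>" "\<bar>y\<bar>"] by (intro mult_left_mono) auto
  also have "\<dots> < A * x\<^sup>2 + D * y\<^sup>2"
  proof -
    have "0 < (A - \<bar>m\<bar>) * x\<^sup>2 \<or> 0 < (D - \<bar>m\<bar>) * y\<^sup>2" "0 \<le> (A - \<bar>m\<bar>) * x\<^sup>2" "0 \<le> (D - \<bar>m\<bar>) * y\<^sup>2"
      using assms by auto
    then show ?thesis
      by (auto simp: algebra_simps)
  qed
  finally show ?thesis
    by simp
qed

lemma Boussinesq_form_pos:
  fixes z :: "(real^4) \<times> real \<times> real"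
  assumes "b > 0" "b2 > 0" "\<bar>\<omega>\<bar> < Min {1, -a / b, -c / b, a2 / b2, c2 / b2}" and "z \<noteq> 0"
  shows "0 < Boussinesq_form a a2 c c2 b b2 \<omega> z z"
proof -
  let ?form = "\<lambda>m A D x y. A * x\<^sup>2 + D * y\<^sup>2 - 2 * m * (x * y)"
  define q1 where "q1 = ?form \<omega> 1 1 (fst z $ 1) (fst z $ 3)"
  define q2 where "q2 = ?form (\<omega> * b) (- c) (- a) (fst z $ 2) (fst z $ 4)"
  define q3 where "q3 = ?form (\<omega> * b2) c2 a2 (fst (snd z)) (snd (snd z))"
  have \<omega>: "\<bar>\<omega>\<bar> < 1" "\<bar>\<omega> * b\<bar> < - a" "\<bar>\<omega> * b\<bar> < - c" "\<bar>\<omega> * b2\<bar> < a2" "\<bar>\<omega> * b2\<bar> < c2"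
    using assms(1-3) pos_less_divide_eq[of b "\<bar>\<omega>\<bar>" "- a"] pos_less_divide_eq[of b "\<bar>\<omega>\<bar>" "- c"]
    by (auto simp: abs_mult pos_less_divide_eq)
  note pos = binary_form_pos[OF \<omega>(1,1), of "fst z $ 1" "fst z $ 3", folded q1_def]
    binary_form_pos[OF \<omega>(3,2), of "fst z $ 2" "fst z $ 4", folded q2_def]
    binary_form_pos[OF \<omega>(5,4), of "fst (snd z)" "snd (snd z)", folded q3_def]
  have nonneg: "0 \<le> q1" "0 \<le> q2" "0 \<le> q3"
    using pos by (fastforce simp: q1_def q2_def q3_def)+
  have "fst z $ 1 \<noteq> 0 \<or> fst z $ 3 \<noteq> 0
      \<or> fst z $ 2 \<noteq> 0 \<or> fst z $ 4 \<noteq> 0 \<or> fst (snd z) \<noteq> 0 \<or> snd (snd z) \<noteq> 0"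
    using \<open>z \<noteq> 0\<close> by (auto simp: prod_eq_iff vec_eq_iff forall_4)
  then have "0 < q1 + q2 + q3"
    using pos nonneg by linarith
  also have "q1 + q2 + q3 = Boussinesq_form a a2 c c2 b b2 \<omega> z z"
    by (simp add: q1_def q2_def q3_def Boussinesq_form_def power2_eq_square algebra_simps)
  finally show ?thesis .
qed

lemma Iw_eq_integral_Boussinesq_form:
  assumes "H2 \<psi>" "H2 v"
  shows "Iw a a2 c c2 b b2 \<omega> \<psi> v =
    (LINT x|lborel. Boussinesq_form a a2 c c2 b b2 \<omega> (jet \<psi> v x) (jet \<psi> v x))"
proof -
  note sq_int = H2D(1-3)[OF assms(1)] H2D(1-3)[OF assms(2)]
  have "integrable lborel (\<lambda>x. (\<psi> x)\<^sup>2 - c * (wd \<psi> x)\<^sup>2 + c2 * (wd (wd \<psi>) x)\<^sup>2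
      + (v x)\<^sup>2 - a * (wd v x)\<^sup>2 + a2 * (wd (wd v) x)\<^sup>2)"
    using sq_int by (auto simp: sq_int_def)
  moreover have "integrable lborel (\<lambda>x. \<psi> x * v x + b * wd \<psi> x * wd v x
      + b2 * wd (wd \<psi>) x * wd (wd v) x)"
    using integrable_sq_int_mult[OF sq_int(1,4)] integrable_sq_int_mult[OF sq_int(2,5)]
      integrable_sq_int_mult[OF sq_int(3,6)]
    by (simp add: mult.assoc)
  ultimately have "Iw a a2 c c2 b b2 \<omega> \<psi> v =
      (LINT x|lborel. ((\<psi> x)\<^sup>2 - c * (wd \<psi> x)\<^sup>2 + c2 * (wd (wd \<psi>) x)\<^sup>2
      + (v x)\<^sup>2 - a * (wd v x)\<^sup>2 + a2 * (wd (wd v) x)\<^sup>2)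
      - 2 * \<omega> * (\<psi> x * v x + b * wd \<psi> x * wd v x + b2 * wd (wd \<psi>) x * wd (wd v) x))"
    unfolding Iw_def I1_def I2_def by simp
  also have "\<dots> = (LINT x|lborel. Boussinesq_form a a2 c c2 b b2 \<omega> (jet \<psi> v x) (jet \<psi> v x))"
    by (intro Bochner_Integration.integral_cong)
      (simp_all add: Boussinesq_form_def jet_def power2_eq_square algebra_simps)
  finally show ?thesis .
qed

locale Boussinesq =
  fixes a a2 c c2 b b2 \<omega> p :: real and F :: "real^4 \<Rightarrow> real"
  assumes b_pos: "0 < b" and b2_pos: "0 < b2"
    and \<omega>_small: "\<bar>\<omega>\<bar> < Min {1, -a / b, -c / b, a2 / b2, c2 / b2}"
    and C2_F: "C2_R4 F" and F_0: "F 0 = 0" and p_pos: "0 < p"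
    and superquadratic: "(p + 2) * Gfun F w \<le> w \<bullet> grad (Gfun F) w"
begin

abbreviation B where "B \<equiv> Boussinesq_form a a2 c c2 b b2 \<omega>"
abbreviation J where "J \<equiv> Jw a a2 c c2 b b2 \<omega> F"
abbreviation P where "P \<equiv> Pw a a2 c c2 b b2 \<omega> F"
abbreviation S where "S \<equiv> Sw a a2 c c2 b b2 \<omega> F"

sublocale superquadratic_energy lborel B F "grad F" p
proof (rule superquadratic_energy.intro)
  show "bounded_bilinear B"
    by (rule bounded_bilinear_Boussinesq_form)
  show "B y z = B z y" for y z
    by (rule Boussinesq_form_sym)
  show "0 < B z z" if "z \<noteq> 0" for z
    using b_pos b2_pos \<omega>_small that by (rule Boussinesq_form_pos)
  show "(F has_derivative (\<lambda>h. grad F w \<bullet> h)) (at w)" for w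
    by (rule C2_R4_has_derivative(1)[OF C2_F])
  show "\<exists>C. C-lipschitz_on (cball 0 R) (grad F)" for R
    by (rule C2_R4_grad_lipschitz[OF C2_F])
  show "t powr (p + 2) * (grad F w \<bullet> w) \<le> grad F (t *\<^sub>R w) \<bullet> (t *\<^sub>R w)" if "1 \<le> t" for t w
  proof -
    have "t powr (p + 2) * Gfun F w \<le> Gfun F (t *\<^sub>R w)"
      using C2_R4_has_derivative(3)[OF C2_F] _ that
    proof (rule Euler_inequality_scaling)
      show "(p + 2) * Gfun F w \<le> grad (Gfun F) w \<bullet> w" for w
        using superquadratic[of w] by (simp add: inner_commute)
    qed
    then show ?thesis
      by (simp only: Gfun_def inner_commute)
  qed
qed (fact F_0 p_pos)+

lemma Jw_eq_energy:
  assumes "H2 \<psi>" "H2 v"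
  shows "J \<psi> v = energy (jet \<psi> v)"
  unfolding energy_split[OF jet_in_energy_space[OF assms]] Jw_def
    Iw_eq_integral_Boussinesq_form[OF assms] Kfun_def
  by (simp add: quadratic.energy_def potential.energy_def) (simp add: jet_def)

lemma Pw_eq_energy_deriv:
  assumes "H2 \<psi>" "H2 v"
  shows "P \<psi> v = energy_deriv (jet \<psi> v) (jet \<psi> v)"
  unfolding energy_deriv_split[OF jet_in_energy_space[OF assms] jet_in_energy_space[OF assms]]
    Pw_def Iw_eq_integral_Boussinesq_form[OF assms] Nfun_def
  by (simp add: quadratic.energy_deriv_def potential.energy_deriv_def)
    (simp add: jet_def Gfun_def inner_commute)

lemma jet_lincomb_energy:
  assumes sobolev: "H2 \<psi>" "H2 v" "H2 h" "H2 k"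
    and W: "W = (\<lambda>x. \<alpha> *\<^sub>R jet \<psi> v x + \<beta> *\<^sub>R jet h k x)"
  shows "J (\<lambda>x. \<alpha> * \<psi> x + \<beta> * h x) (\<lambda>x. \<alpha> * v x + \<beta> * k x) = energy W"
    and "P (\<lambda>x. \<alpha> * \<psi> x + \<beta> * h x) (\<lambda>x. \<alpha> * v x + \<beta> * k x) = energy_deriv W W"
  unfolding W Jw_eq_energy[OF H2_lincomb(1)[OF sobolev(1,3)] H2_lincomb(1)[OF sobolev(2,4)]]
    Pw_eq_energy_deriv[OF H2_lincomb(1)[OF sobolev(1,3)] H2_lincomb(1)[OF sobolev(2,4)]]
  by (intro energy_cong_AE jet_lincomb jet_in_energy_space energy_space_lincomb
      H2_lincomb(1) sobolev)+

lemma Sw_le_Jw: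
  assumes "H2 \<psi>" "H2 v" "P \<psi> v = 0" "\<not> X_zero \<psi> v"
  shows "S \<le> J \<psi> v"
  unfolding Sw_def
proof (rule cInf_lower)
  show "bdd_below {J \<psi> v | \<psi> v.
      H2 \<psi> \<and> H2 v \<and> P \<psi> v = 0 \<and> \<not> X_zero \<psi> v}"
    by (rule bdd_belowI[of _ 0])
      (auto simp: Jw_eq_energy Pw_eq_energy_deriv
        intro!: energy_nonneg_on_Nehari jet_in_energy_space)
qed (use assms in blast)

lemma ground_state_energy_deriv_zero:
  assumes ground: "H2 \<psi>0" "H2 v0" and P: "P \<psi>0 v0 = 0"
    and J: "J \<psi>0 v0 = S" and test: "H2 h" "H2 k"
  shows "energy_deriv (jet \<psi>0 v0) (jet h k) = 0"
proof (rule ground_state_critical)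
  show "energy_deriv (jet \<psi>0 v0) (jet \<psi>0 v0) = 0"
    using P by (simp add: Pw_eq_energy_deriv ground)
  fix \<alpha> \<beta> W
  assume W: "W = (\<lambda>x. \<alpha> *\<^sub>R jet \<psi>0 v0 x + \<beta> *\<^sub>R jet h k x)"
    and "energy_deriv W W = 0" and nonzero: "\<not> (AE x in lborel. W x = 0)"
  let ?\<psi> = "\<lambda>x. \<alpha> * \<psi>0 x + \<beta> * h x" and ?v = "\<lambda>x. \<alpha> * v0 x + \<beta> * k x"
  have perturbed: "H2 ?\<psi>" "H2 ?v"
    using H2_lincomb(1) ground test by auto
  have "\<not> X_zero ?\<psi> ?v"
  proof
    assume "X_zero ?\<psi> ?v"
    with jet_lincomb[OF ground test, of \<alpha> \<beta>] have "AE x in lborel. W x = 0"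
      using X_zero_imp_jet_zero[OF perturbed] unfolding W by (auto elim: eventually_elim2)
    with nonzero show False ..
  qed
  then have "S \<le> J ?\<psi> ?v"
    using perturbed \<open>energy_deriv W W = 0\<close> jet_lincomb_energy(2)[OF ground test W]
    by (intro Sw_le_Jw) auto
  then show "energy (jet \<psi>0 v0) \<le> energy W"
    using J by (simp add: jet_lincomb_energy(1)[OF ground test W] Jw_eq_energy[OF ground])
qed (use jet_in_energy_space ground test in auto)

lemma Jw_criticalI:
  assumes state: "H2 \<psi>0" "H2 v0"
    and deriv_0: "\<And>h k. H2 h \<Longrightarrow> H2 k \<Longrightarrow> energy_deriv (jet \<psi>0 v0) (jet h k) = 0"
  shows "Jw_critical a a2 c c2 b b2 \<omega> F \<psi>0 v0"
  unfolding Jw_critical_def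
proof (intro allI impI)
  fix \<epsilon> :: real assume "\<epsilon> > 0"
  obtain C where C: "C \<ge> 0" "\<And>Y. Y \<in> energy_space lborel \<Longrightarrow> AE x in lborel. norm (fst (Y x)) \<le> 1 \<Longrightarrow>
      \<bar>energy (\<lambda>x. jet \<psi>0 v0 x + Y x) - energy (jet \<psi>0 v0) - energy_deriv (jet \<psi>0 v0) Y\<bar>
        \<le> C * (LINT x|lborel. (norm (Y x))\<^sup>2)"
    by (rule energy_frechet_bound[OF jet_in_energy_space[OF state]]) blast
  have "\<bar>J (\<lambda>x. \<psi>0 x + h x) (\<lambda>x. v0 x + k x) - J \<psi>0 v0\<bar> \<le> \<epsilon> * X_norm h k"
    if test: "H2 h" "H2 k" and small: "X_norm h k < min (1/2) (\<epsilon> / (C + 1))" for h k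
  proof -
    have "J (\<lambda>x. \<psi>0 x + h x) (\<lambda>x. v0 x + k x) = energy (\<lambda>x. jet \<psi>0 v0 x + jet h k x)"
      using jet_lincomb_energy(1)[OF state test refl, of 1 1] by simp
    moreover have "AE x in lborel. norm (fst (jet h k x)) \<le> 1"
      using jet_AE_bounded[OF test] small by (auto elim: eventually_mono)
    ultimately have "\<bar>J (\<lambda>x. \<psi>0 x + h x) (\<lambda>x. v0 x + k x) - J \<psi>0 v0\<bar> \<le> C * (X_norm h k)\<^sup>2"
      using C(2)[OF jet_in_energy_space[OF test]] deriv_0[OF test] Jw_eq_energy[OF state]
      by (simp add: integral_norm_jet_sq(2)[OF test])
    also have "\<dots> \<le> (C + 1) * X_norm h k * X_norm h k"
      by (simp add: power2_eq_square algebra_simps)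
    also have "\<dots> \<le> \<epsilon> * X_norm h k"
      using small C(1) by (intro mult_right_mono X_norm_nonneg) (auto simp: field_simps)
    finally show ?thesis .
  qed
  then show "\<exists>\<delta>>0. \<forall>h k. H2 h \<and> H2 k \<and> X_norm h k < \<delta> \<longrightarrow>
      \<bar>J (\<lambda>x. \<psi>0 x + h x) (\<lambda>x. v0 x + k x) - J \<psi>0 v0\<bar> \<le> \<epsilon> * X_norm h k"
    using \<open>\<epsilon> > 0\<close> C(1) by (intro exI[of _ "min (1/2) (\<epsilon> / (C + 1))"]) auto
qed

end

theorem theorem2p5:
  fixes a c a2 c2 b b2 \<omega> :: real
    and F :: "real^4 \<Rightarrow> real"
    and \<psi>0 v0 :: "real \<Rightarrow> real"
  assumes "a < 0" "c < 0" "a2 > 0" "c2 > 0" "b > 0" "b2 > 0"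
    and "0 < \<bar>\<omega>\<bar>"
    and "\<bar>\<omega>\<bar> < Min {1, -a / b, -c / b, a2 / b2, c2 / b2}"
    and "C2_R4 F" and "F 0 = 0"
    and cond_a: "\<exists>p>0. \<forall>w. w \<bullet> grad (Gfun F) w \<ge> (p + 2) * Gfun F w"
    and cond_b: "\<exists>q1 q2 C. 0 < q1 \<and> q1 \<le> q2 \<and> C > 0 \<and>
                   (\<forall>w. norm (hess F w) \<le> C * (norm w powr q1 + norm w powr q2))"
    and cond_c: "\<exists>u v. H2 u \<and> H2 v \<and>
                   (LINT x|lborel. F (vec4 (u x) (wd u x) (v x) (wd v x))) > 0"
    and "H2 \<psi>0" "H2 v0"
    and "Pw a a2 c c2 b b2 \<omega> F \<psi>0 v0 = 0"
    and "Jw a a2 c c2 b b2 \<omega> F \<psi>0 v0 = Sw a a2 c c2 b b2 \<omega> F"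
  shows "Jw_critical a a2 c c2 b b2 \<omega> F \<psi>0 v0"
proof -
  obtain p where "p > 0" "\<And>w. w \<bullet> grad (Gfun F) w \<ge> (p + 2) * Gfun F w"
    using cond_a by blast
  then interpret Boussinesq a a2 c c2 b b2 \<omega> p F
    by unfold_locales (use assms in auto)
  show ?thesis
    using assms by (intro Jw_criticalI ground_state_energy_deriv_zero)
qed

end
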